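(* Let $\Omega\subset\mathbb C^m$ be a bounded domain and $K:\Omega\times\Omega\to\mathbb C$ be a sesqui-analytic function such that the functions $K^\alpha$ and $K^\beta$ are non-negative definite on $\Omega\times\Omega$ for some $\alpha,\beta>0$. For $z$ in $\Omega$ and $1\le i,j\le m$, we have $$\lim_{\substack{\zeta_i\to z_i\\ \zeta_j\to z_j}}\left(\frac{K_{\mathcal A_0}(z,\zeta;z,\zeta)}{(z_i-\zeta_i)(\bar z_j-\bar\zeta_j)}\bigg|_{\zeta_l=z_l,\ l\ne i,j}\right)=\frac{\alpha\beta}{\alpha+\beta}\,K(z,z)^{\alpha+\beta}\,\partial_i\bar\partial_j\log K(z,z),$$ where $K_{\mathcal A_0}$ is the reproducing kernel of the subspace $$\mathcal A_0=\{f\in(\mathcal H,K^\alpha)\otimes(\mathcal H,K^\beta): f(z,z)=0\ \text{for all } z\in\Omega\},$$ and $\frac{K_{\mathcal A_0}(z,\zeta;z,\zeta)}{(z_i-\zeta_i)(\bar z_j-\bar\zeta_j)}\Big|_{\zeta_l=z_l,\ l\ne i,j}$ is the restriction of the function $\frac{K_{\mathcal A_0}(z,\zeta;z,\zeta)}{(z_i-\zeta_i)(\bar z_j-\bar\zeta_j)}$ to the set $\{(z,\zeta)\in\Omega\times\Omega: z_l=\zeta_l,\ l=1,\ldots,m,\ l\ne i,j\}$.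
   Context: $K:\Omega\times\Omega\to\mathbb C$ is sesqui-analytic if $K(z,w)$ is holomorphic in $z$ and anti-holomorphic in $w$. A scalar kernel is non-negative definite if $(K(x_i,x_j))_{i,j=1}^p$ is a non-negative definite matrix for every finite set of points $x_1,\dots,x_p$. Non-negative definite kernels, in particular the powers $K^\alpha$ and $K^\beta$, are taken to be sesqui-analytic. $(\mathcal H,K)$ denotes the reproducing kernel Hilbert space with reproducing kernel $K$. The tensor product $(\mathcal H,K_1)\otimes(\mathcal H,K_2)$ is identified with the reproducing kernel Hilbert space of holomorphic functions $f(z,\zeta)$ on $\Omega\times\Omega$ with kernel $(K_1\otimes K_2)(z,\zeta;w,\rho)=K_1(z,w)K_2(\zeta,\rho)$, where $z,\zeta,w,\rho\in\Omega$. The reproducing kernel of the closed subspace $\mathcal A_0$ is written $K_{\mathcal A_0}(z,\zeta;w,\rho)$. Here $\partial_i=\frac{\partial}{\partial z_i}$, $\bar\partial_j=\frac{\partial}{\partial\bar w_j}$, and $\partial_i\bar\partial_j\log K(z,z)$ means $(\partial_i\bar\partial_j\log K)(z,w)$ evaluated at $w=z$.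
   Formalization: For i≠j the printed limit fails (e.g. unit ball, K=1/(1-<z,w>)); proved instead: the limit of K_A0(z,ζ;z,ρ)/((z_i-ζ_i)(z̄_j-ρ̄_j)) with ζ varying only in coordinate i and ρ only in coordinate j, independently. K(z,z)≠0 is assumed so that log K exists near (z,z). *)

theory Defs
  imports "HOL-Analysis.Analysis"
begin

(* A function of (z, w) that is real differentiable with a derivative that is complex linear in
   the z-direction and conjugate linear in the w-direction: (z, w) |-> K z (cnj w) is holomorphic
   in the 2m complex variables. *)
definition sesqui_analytic_on ::
    "(complex^'m) set \<Rightarrow> (complex^'m \<Rightarrow> complex^'m \<Rightarrow> complex) \<Rightarrow> bool" where
  "sesqui_analytic_on \<Omega> K \<longleftrightarrow>
     (\<forall>z\<in>\<Omega>. \<forall>w\<in>\<Omega>. \<exists>D. ((\<lambda>p. K (fst p) (snd p)) has_derivative D) (at (z, w)) \<and>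
        (\<forall>c v. D (c *s v, 0) = c * D (v, 0)) \<and>
        (\<forall>c v. D (0, c *s v) = cnj c * D (0, v)))"

definition partial :: "'m \<Rightarrow> (complex^'m \<Rightarrow> complex) \<Rightarrow> complex^'m \<Rightarrow> complex" where
  "partial i f z = deriv (\<lambda>t. f (z + t *s axis i 1)) 0"

(* For f anti-holomorphic in the j-th coordinate, the derivative with respect to the conjugate
   variable is the conjugate of the derivative of the holomorphic function cnj f. *)
definition partial_bar :: "'m \<Rightarrow> (complex^'m \<Rightarrow> complex) \<Rightarrow> complex^'m \<Rightarrow> complex" where
  "partial_bar j f w = cnj (deriv (\<lambda>t. cnj (f (w + t *s axis j 1))) 0)"

definition mixed_partial ::
    "'m \<Rightarrow> 'm \<Rightarrow> (complex^'m \<Rightarrow> complex^'m \<Rightarrow> complex) \<Rightarrow> complex^'m \<Rightarrow> complex^'m \<Rightarrow> complex" where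
  "mixed_partial i j F z w = partial i (\<lambda>u. partial_bar j (F u) w) z"

definition nonneg_definite_on :: "'x set \<Rightarrow> ('x \<Rightarrow> 'x \<Rightarrow> complex) \<Rightarrow> bool" where
  "nonneg_definite_on X k \<longleftrightarrow>
     (\<forall>F c. finite F \<and> F \<subseteq> X \<longrightarrow> (\<Sum>x\<in>F. \<Sum>y\<in>F. cnj (c x) * k x y * c y) \<in> \<real>\<^sub>\<ge>\<^sub>0)"

(* P is a sesqui-analytic determination of K^a.  Since P is continuous and the values of K^a at a
   point form a countable set, P agrees, near every point where K does not vanish, with
   exp (a * l) for a sesqui-analytic logarithm l of K.  For a kernel P that is moreover
   non-negative definite, P u u is the real power |K u u|^a. *)
definition kernel_power_on ::
    "(complex^'m) set \<Rightarrow> (complex^'m \<Rightarrow> complex^'m \<Rightarrow> complex) \<Rightarrow> real \<Rightarrow>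
     (complex^'m \<Rightarrow> complex^'m \<Rightarrow> complex) \<Rightarrow> bool" where
  "kernel_power_on \<Omega> K a P \<longleftrightarrow> sesqui_analytic_on \<Omega> P \<and>
     (\<forall>z\<in>\<Omega>. \<forall>w\<in>\<Omega>. if K z w = 0 then P z w = 0
        else \<exists>l. exp l = K z w \<and> P z w = exp (of_real a * l))"

(* L is a sesqui-analytic branch of log K near (z, z).  One exists exactly when K z z is nonzero,
   and two of them differ by a constant near (z, z). *)
definition log_branch_near ::
    "complex^'m \<Rightarrow> (complex^'m \<Rightarrow> complex^'m \<Rightarrow> complex) \<Rightarrow>
     (complex^'m \<Rightarrow> complex^'m \<Rightarrow> complex) \<Rightarrow> bool" where
  "log_branch_near z K L \<longleftrightarrow>
     (\<exists>U. open U \<and> z \<in> U \<and> sesqui_analytic_on U L \<and> (\<forall>u\<in>U. \<forall>w\<in>U. exp (L u w) = K u w))"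

(* Functions on X are represented by functions on the whole type that vanish outside X;
   ip is linear in its first argument. *)
definition function_hilbert_space ::
    "'x set \<Rightarrow> ('x \<Rightarrow> complex) set \<Rightarrow> (('x \<Rightarrow> complex) \<Rightarrow> ('x \<Rightarrow> complex) \<Rightarrow> complex) \<Rightarrow> bool" where
  "function_hilbert_space X H ip \<longleftrightarrow>
     (\<forall>f\<in>H. \<forall>x. x \<notin> X \<longrightarrow> f x = 0) \<and>
     (\<lambda>x. 0) \<in> H \<and>
     (\<forall>f\<in>H. \<forall>g\<in>H. (\<lambda>x. f x + g x) \<in> H) \<and>
     (\<forall>c. \<forall>f\<in>H. (\<lambda>x. c * f x) \<in> H) \<and>
     (\<forall>f\<in>H. \<forall>g\<in>H. \<forall>h\<in>H. ip (\<lambda>x. f x + g x) h = ip f h + ip g h) \<and>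
     (\<forall>c. \<forall>f\<in>H. \<forall>h\<in>H. ip (\<lambda>x. c * f x) h = c * ip f h) \<and>
     (\<forall>f\<in>H. \<forall>g\<in>H. ip g f = cnj (ip f g)) \<and>
     (\<forall>f\<in>H. ip f f \<in> \<real>\<^sub>\<ge>\<^sub>0 \<and> (ip f f = 0 \<longrightarrow> f = (\<lambda>x. 0))) \<and>
     (\<forall>s. (\<forall>n::nat. s n \<in> H) \<and>
          (\<forall>e>0. \<exists>N. \<forall>m\<ge>N. \<forall>n\<ge>N.
             sqrt (Re (ip (\<lambda>x. s m x - s n x) (\<lambda>x. s m x - s n x))) < e) \<longrightarrow>
          (\<exists>f\<in>H. (\<lambda>n. sqrt (Re (ip (\<lambda>x. s n x - f x) (\<lambda>x. s n x - f x)))) \<longlonglongrightarrow> 0))"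

definition kernel_section :: "'x set \<Rightarrow> ('x \<Rightarrow> 'x \<Rightarrow> complex) \<Rightarrow> 'x \<Rightarrow> 'x \<Rightarrow> complex" where
  "kernel_section X k y = (\<lambda>x. if x \<in> X then k x y else 0)"

(* S is a space of functions on X, possibly a closed subspace of a larger one, with the inner
   product ip. *)
definition reproducing_kernel ::
    "'x set \<Rightarrow> ('x \<Rightarrow> complex) set \<Rightarrow> (('x \<Rightarrow> complex) \<Rightarrow> ('x \<Rightarrow> complex) \<Rightarrow> complex) \<Rightarrow>
     ('x \<Rightarrow> 'x \<Rightarrow> complex) \<Rightarrow> bool" where
  "reproducing_kernel X S ip k \<longleftrightarrow>
     (\<forall>y\<in>X. kernel_section X k y \<in> S) \<and>
     (\<forall>f\<in>S. \<forall>y\<in>X. f y = ip f (kernel_section X k y))"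

definition rkhs ::
    "'x set \<Rightarrow> ('x \<Rightarrow> complex) set \<Rightarrow> (('x \<Rightarrow> complex) \<Rightarrow> ('x \<Rightarrow> complex) \<Rightarrow> complex) \<Rightarrow>
     ('x \<Rightarrow> 'x \<Rightarrow> complex) \<Rightarrow> bool" where
  "rkhs X H ip k \<longleftrightarrow> function_hilbert_space X H ip \<and> reproducing_kernel X H ip k"

definition tensor_kernel ::
    "('x \<Rightarrow> 'x \<Rightarrow> complex) \<Rightarrow> ('x \<Rightarrow> 'x \<Rightarrow> complex) \<Rightarrow> 'x \<times> 'x \<Rightarrow> 'x \<times> 'x \<Rightarrow> complex" where
  "tensor_kernel k1 k2 p q = k1 (fst p) (fst q) * k2 (snd p) (snd q)"

definition vanish_on_diagonal :: "'x set \<Rightarrow> ('x \<times> 'x \<Rightarrow> complex) set \<Rightarrow> ('x \<times> 'x \<Rightarrow> complex) set" where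
  "vanish_on_diagonal \<Omega> H = {f\<in>H. \<forall>z\<in>\<Omega>. f (z, z) = 0}"

(* The points of \<Omega> that agree with z in all coordinates outside I.  In a limit of
     KA (z, \<zeta>) (z, \<rho>) / ((z_i - \<zeta>_i) * (cnj z_j - cnj \<rho>_j))
   the holomorphic point \<zeta> ranges over coord_slice \<Omega> z {i} and the anti-holomorphic point \<rho> over
   coord_slice \<Omega> z {j}.  For i \<noteq> j these points must be kept apart: on \<rho> = \<zeta> the numerator is
   non-negative and has no limit when divided by (z_i - \<zeta>_i) * (cnj z_j - cnj \<zeta>_j), unless that
   limit is 0. *)
definition coord_slice :: "(complex^'m) set \<Rightarrow> complex^'m \<Rightarrow> 'm set \<Rightarrow> (complex^'m) set" where
  "coord_slice \<Omega> z I = {\<zeta>\<in>\<Omega>. \<forall>l. l \<notin> I \<longrightarrow> \<zeta> $ l = z $ l}"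

end

theory Submission
  imports Defs "HOL-Complex_Analysis.Complex_Analysis"
begin

text \<open>
  Write \<open>k\<close> for the tensor kernel.  At a point of the diagonal the difference quotients of the
  sections of \<open>k\<close> converge in norm, because their Gram matrix is formed from second difference quotients
  of a function that is holomorphic on a bidisc.  The limit \<open>E\<close>, for a motion of the second point
  alone in the direction \<open>j\<close>, represents the corresponding derivative of functions in the space
  (\<open>kernel_derivative_representer\<close>, \<open>tensor_derivative_representer\<close>).

  The kernel \<open>KA\<close> of the subspace of functions vanishing on the diagonal has as sections the orthogonal
  projections of the sections of \<open>k\<close>, and the projection of the section at \<open>(z, z)\<close> is zero.  Therefore
  the section of \<open>KA\<close> at \<open>(z, \<rho>)\<close>, divided by the conjugate of \<open>\<rho> $ j - z $ j\<close>, tends to the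
  projection \<open>V\<close> of \<open>E\<close>, and the quotient in the theorem, an inner product of two such normalized
  sections, tends to the inner product of the projections for the directions \<open>j\<close> and \<open>i\<close>.

  The projection can be written down.  Differentiation along the diagonal is represented by a vector
  \<open>G\<close> orthogonal to the subspace.  On the diagonal, \<open>E\<close> and \<open>G\<close> are \<open>\<beta>\<close> and \<open>\<alpha> + \<beta>\<close> times the same function,
  because the logarithmic derivatives of \<open>K\<^sup>\<alpha>\<close> and \<open>K\<^sup>\<beta>\<close> are proportional to that of \<open>K\<close>
  (\<open>conj_deriv_powers_proportional\<close>).  So \<open>V\<close> is \<open>E\<close> minus \<open>\<beta> / (\<alpha> + \<beta>)\<close> times \<open>G\<close>
  (\<open>projected_derivative\<close>).

  In terms of a logarithm \<open>L\<close> of \<open>K\<close> near \<open>z\<close>, the value \<open>V (z, w)\<close> is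
  \<open>\<alpha> \<beta> / (\<alpha> + \<beta>) * K\<^sup>\<alpha>(z, z) * K\<^sup>\<beta>(w, z)\<close> times the increment from \<open>z\<close> to \<open>w\<close> of the derivative
  of \<open>L\<close> with respect to the \<open>j\<close>-th conjugate variable.  The derivative of this in the \<open>i\<close>-th coordinate
  of \<open>w\<close> at \<open>w = z\<close> is the asserted limit (\<open>vanishing_kernel_quotient_tendsto\<close>).
\<close>

section \<open>Difference quotients of holomorphic functions and powers of holomorphic functions\<close>

definition diff_quot :: "(complex \<Rightarrow> complex) \<Rightarrow> complex \<Rightarrow> complex" where
  "diff_quot f s = (if s = 0 then deriv f 0 else (f s - f 0) / s)"

lemma diff_quot_holomorphic:
  "f holomorphic_on ball 0 R \<Longrightarrow> diff_quot f holomorphic_on ball 0 R"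
  using pole_lemma_open[of f "ball 0 R" 0] by (simp add: diff_quot_def[abs_def] cong: if_cong)

lemma diff_quot_tendsto:
  assumes "f holomorphic_on ball 0 R" "R > 0"
  shows "((\<lambda>s. (f s - f 0) / s) \<longlongrightarrow> deriv f 0) (at 0)"
proof -
  have "f field_differentiable at 0"
    using assms by (intro holomorphic_on_imp_differentiable_at[of f "ball 0 R"]) auto
  then have "(f has_field_derivative deriv f 0) (at 0)"
    by (simp add: DERIV_deriv_iff_field_differentiable)
  then show ?thesis by (simp add: has_field_derivative_iff)
qed

text \<open>On the circle of radius \<^term>\<open>r\<close> the bound is the triangle inequality; the quotient extends
  holomorphically across the origin, so the maximum principle carries the bound inside.  Since the
  quotient is again holomorphic on the same disc, the estimate can be iterated, and a second
  application controls how fast the quotient approaches the derivative.\<close>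

lemma diff_quot_bound:
  assumes hol: "f holomorphic_on ball 0 R" and r: "0 < r" "r < R"
    and bd: "\<And>s. s \<in> cball 0 r \<Longrightarrow> cmod (f s) \<le> M" and s: "s \<in> cball 0 r"
  shows "cmod (diff_quot f s) \<le> 2 * M / r"
proof -
  have sub: "cball 0 r \<subseteq> ball (0::complex) R" using r by auto
  have h: "diff_quot f holomorphic_on cball 0 r"
    using diff_quot_holomorphic[OF hol] sub by (rule holomorphic_on_subset)
  have "cmod (diff_quot f w) \<le> 2 * M / r" if "w \<in> frontier (cball 0 r)" for w
  proof -
    have w: "cmod w = r" using that r by simp
    then have "w \<noteq> 0" using r by auto
    have "cmod (f w - f 0) \<le> M + M"
      by (rule order_trans[OF norm_triangle_ineq4]) (intro add_mono bd, use w r in auto)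
    then show ?thesis using w \<open>w \<noteq> 0\<close> r
      by (simp add: diff_quot_def norm_divide divide_right_mono)
  qed
  then show ?thesis
    using maximum_modulus_frontier[of "diff_quot f" "cball 0 r" "2 * M / r" s] h s
      holomorphic_on_imp_continuous_on[OF h] holomorphic_on_subset[OF h ball_subset_cball]
    by auto
qed

text \<open>Boundedness on a bidisc makes the difference quotient in \<open>s\<close> converge uniformly in \<open>t\<close>, at a
  rate proportional to \<open>cmod s\<close>.  Hence the limit is holomorphic in \<open>t\<close>.  For the joint limit, the
  error is itself holomorphic in \<open>t\<close>, so its difference quotient in \<open>t\<close> is again of size
  \<open>cmod s\<close> by the same estimate.\<close>

lemma
  assumes r: "0 < r" "r < R"
    and hol1: "\<And>t. t \<in> ball 0 R \<Longrightarrow> (\<lambda>s. \<phi> s t) holomorphic_on ball 0 R"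
    and hol2: "\<And>s. s \<in> ball 0 R \<Longrightarrow> (\<lambda>t. \<phi> s t) holomorphic_on ball 0 R"
    and bd: "\<And>s t. s \<in> cball 0 r \<Longrightarrow> t \<in> cball 0 r \<Longrightarrow> cmod (\<phi> s t) \<le> M"
  shows holomorphic_on_parameter_deriv: "(\<lambda>t. deriv (\<lambda>s. \<phi> s t) 0) holomorphic_on ball 0 r"
    and second_diff_quot_tendsto:
      "((\<lambda>(s, t). (\<phi> s t - \<phi> 0 t - \<phi> s 0 + \<phi> 0 0) / (s * t)) \<longlongrightarrow>
          deriv (\<lambda>t. deriv (\<lambda>s. \<phi> s t) 0) 0) (at 0 \<times>\<^sub>F at 0)"
proof -
  define g where "g s t = diff_quot (\<lambda>s. \<phi> s t) s" for s t
  have g0: "g 0 = (\<lambda>t. deriv (\<lambda>s. \<phi> s t) 0)" by (auto simp: g_def diff_quot_def)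
  \<comment> \<open>The Lipschitz constant of the difference quotient in its own variable.\<close>
  define C where "C = 2 * (2 * M / r) / r"
  have C: "cmod (g s t - g 0 t) \<le> C * cmod s" if "s \<in> cball 0 r" "t \<in> cball 0 r" for s t
  proof (cases "s = 0")
    case False
    have h: "(\<lambda>s. \<phi> s t) holomorphic_on ball 0 R" using that r by (intro hol1) auto
    have "cmod (diff_quot (\<lambda>s. g s t) s) \<le> C" unfolding C_def
    proof (rule diff_quot_bound[where R = R])
      show "(\<lambda>s. g s t) holomorphic_on ball 0 R"
        unfolding g_def using diff_quot_holomorphic[OF h] by simp
      show "cmod (g s t) \<le> 2 * M / r" if "s \<in> cball 0 r" for s
        unfolding g_def by (rule diff_quot_bound[OF h]) (use r bd that \<open>t \<in> _\<close> in auto)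
    qed (use r that in auto)
    then have "cmod ((g s t - g 0 t) / s) \<le> C" using False by (simp add: diff_quot_def)
    then show ?thesis using False by (simp add: norm_divide field_simps)
  qed simp
  have hols: "g s holomorphic_on ball 0 R" if "s \<in> ball 0 R" "s \<noteq> 0" for s
  proof -
    have "(\<lambda>t. (\<phi> s t - \<phi> 0 t) / s) holomorphic_on ball 0 R"
      using that r by (intro holomorphic_intros hol2) auto
    moreover have "g s = (\<lambda>t. (\<phi> s t - \<phi> 0 t) / s)"
      using that by (auto simp: g_def diff_quot_def)
    ultimately show ?thesis by simp
  qed
  have ev: "\<forall>\<^sub>F s in at 0. s \<in> ball 0 r \<and> s \<noteq> (0::complex)"
    using r by (auto simp: eventually_at dist_norm intro!: exI[of _ r])
  have ul: "uniform_limit (cball 0 r) g (g 0) (at 0)"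
  proof (rule uniform_limitI)
    fix e :: real assume e: "e > 0"
    have "((\<lambda>s. C * cmod s) \<longlongrightarrow> C * cmod 0) (at (0::complex))" by (intro tendsto_intros)
    then have "\<forall>\<^sub>F s in at (0::complex). C * cmod s < e"
      using e by (auto dest: order_tendstoD)
    then show "\<forall>\<^sub>F s in at 0. \<forall>t\<in>cball 0 r. dist (g s t) (g 0 t) < e"
      using ev
    proof eventually_elim
      case (elim s)
      then show ?case using C[of s] by (force simp: dist_norm)
    qed
  qed
  have "\<forall>\<^sub>F s in at 0. continuous_on (cball 0 r) (g s) \<and> g s holomorphic_on ball 0 r"
    using ev
  proof eventually_elim
    case (elim s)
    then have "g s holomorphic_on ball 0 R" using r by (intro hols) auto
    then show ?case using r
      by (auto intro!: holomorphic_on_imp_continuous_on elim: holomorphic_on_subset)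
  qed
  then have hol0: "g 0 holomorphic_on ball 0 r"
    using holomorphic_uniform_limit[OF _ ul] by auto
  then show "(\<lambda>t. deriv (\<lambda>s. \<phi> s t) 0) holomorphic_on ball 0 r" by (simp add: g0)
  let ?S = "\<lambda>(s, t). (\<phi> s t - \<phi> 0 t - \<phi> s 0 + \<phi> 0 0) / (s * t)"
  let ?d = "\<lambda>t. (g 0 t - g 0 0) / t"
  have lim: "((\<lambda>p. ?d (snd p)) \<longlongrightarrow> deriv (g 0) 0) (at 0 \<times>\<^sub>F at (0::complex))"
    using diff_quot_tendsto[OF hol0 r(1)] filterlim_snd by (rule filterlim_compose)
  have "\<forall>\<^sub>F p in at 0 \<times>\<^sub>F at 0. cmod (?S p - ?d (snd p)) \<le> cmod (fst p) * (4 * C / r)"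
  proof -
    have ev2: "\<forall>\<^sub>F s in at 0. s \<in> ball 0 (r/2) \<and> s \<noteq> (0::complex)"
      using r by (auto simp: eventually_at dist_norm intro!: exI[of _ "r/2"])
    have "\<forall>\<^sub>F p in at 0 \<times>\<^sub>F at 0. (fst p \<in> ball 0 r \<and> fst p \<noteq> (0::complex)) \<and>
            (snd p \<in> ball 0 (r/2) \<and> snd p \<noteq> (0::complex))"
      using ev ev2 by (auto simp: eventually_prod_filter)
    then show ?thesis
    proof eventually_elim
      case (elim p)
      obtain s t where p: "p = (s, t)" by force
      have s: "s \<in> ball 0 r" "s \<noteq> 0" and t: "t \<in> ball 0 (r/2)" "t \<noteq> 0"
        using elim p by auto
      define \<Delta> where "\<Delta> t = g s t - g 0 t" for t
      have "cmod (diff_quot \<Delta> t) \<le> 2 * (C * cmod s) / (r/2)"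
      proof (rule diff_quot_bound[where R = r])
        have "g s holomorphic_on ball 0 r"
          by (rule holomorphic_on_subset[OF hols]) (use s r in auto)
        then show "\<Delta> holomorphic_on ball 0 r"
          unfolding \<Delta>_def by (intro holomorphic_intros hol0)
        show "cmod (\<Delta> t) \<le> C * cmod s" if "t \<in> cball 0 (r/2)" for t
          unfolding \<Delta>_def by (rule C) (use that s r in auto)
      qed (use r t in auto)
      also have "diff_quot \<Delta> t = ?S p - ?d (snd p)"
        using s t by (simp add: p \<Delta>_def diff_quot_def g_def field_simps)
      finally show ?case by (simp add: p field_simps)
    qed
  qed
  then have "((\<lambda>p. ?S p - ?d (snd p)) \<longlongrightarrow> 0) (at 0 \<times>\<^sub>F at 0)"
  proof (rule Lim_null_comparison)
    have "filterlim fst (nhds 0) (at (0::complex) \<times>\<^sub>F at (0::complex))"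
      by (rule filterlim_compose[OF tendsto_ident_at filterlim_fst])
    then show "((\<lambda>p. cmod (fst p) * (4 * C / r)) \<longlongrightarrow> 0) (at (0::complex) \<times>\<^sub>F at (0::complex))"
      by (intro tendsto_mult_left_zero tendsto_norm_zero)
  qed
  from tendsto_add[OF this lim] show "(?S \<longlongrightarrow> deriv (\<lambda>t. deriv (\<lambda>s. \<phi> s t) 0) 0) (at 0 \<times>\<^sub>F at 0)"
    by (simp add: g0)
qed

text \<open>The identity says that the logarithmic derivative of a determination of \<open>F\<^sup>a\<close> is \<open>a\<close> times that of
  \<open>F\<close>.  The determination is chosen point by point, but it is continuous and can differ from
  \<open>exp (a * h)\<close>, with \<open>h\<close> a holomorphic logarithm of \<open>F\<close>, only by a factor from a countable set; a
  continuous function on a disc with countable range is constant.  In the form without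
  denominators both sides are zero where \<open>F\<close> vanishes.\<close>

lemma deriv_power_branch:
  fixes F P :: "complex \<Rightarrow> complex"
  assumes F: "F holomorphic_on ball 0 R" and P: "P holomorphic_on ball 0 R" and R: "R > 0"
    and pow: "\<And>t. t \<in> ball 0 R \<Longrightarrow>
      if F t = 0 then P t = 0 else \<exists>l. exp l = F t \<and> P t = exp (of_real a * l)"
  shows "deriv P 0 * F 0 = of_real a * deriv F 0 * P 0"
proof (cases "F 0 = 0")
  case True
  then show ?thesis using pow[of 0] R by simp
next
  case False
  have "continuous (at 0) F"
    using F R holomorphic_on_imp_continuous_on[OF F] by (simp add: continuous_on_eq_continuous_at)
  then obtain d where d: "d > 0" "\<And>t. dist 0 t < d \<Longrightarrow> F t \<noteq> 0"
    using continuous_at_avoid[of 0 F 0] False by auto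
  define r where "r = min d R"
  have r: "r > 0" "ball 0 r \<subseteq> ball (0::complex) R" "\<And>t. t \<in> ball 0 r \<Longrightarrow> F t \<noteq> 0"
    using d R by (auto simp: r_def)
  have Fr: "F holomorphic_on ball 0 r" and Pr: "P holomorphic_on ball 0 r"
    using F P r holomorphic_on_subset by blast+
  obtain h where h: "h holomorphic_on ball 0 r" "\<And>t. t \<in> ball 0 r \<Longrightarrow> F t = exp (h t)"
    using simply_connected_eq_holomorphic_log[of "ball 0 r"] Fr r(3)
      convex_imp_simply_connected[of "ball (0::complex) r"] by auto
  \<comment> \<open>The factor by which the pointwise determination differs from the one that belongs to h.\<close>
  define Q where "Q t = P t * exp (- (of_real a * h t))" for t
  have Q: "Q t \<in> range (\<lambda>n. exp (of_real a * (of_real (2 * of_int n * pi) * \<i>)))"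
    if t: "t \<in> ball 0 r" for t
  proof -
    obtain l where l: "exp l = F t" "P t = exp (of_real a * l)"
      using pow[OF subsetD[OF r(2) t]] r(3)[OF t] by auto
    have "exp l = exp (h t)" using l h t by simp
    then obtain n :: int where "l = h t + (of_real (2 * of_int n * pi)) * \<i>"
      by (auto simp: exp_eq)
    then have "Q t = exp (of_real a * (of_real (2 * of_int n * pi) * \<i>))"
      by (simp add: Q_def l(2) flip: exp_add) (simp add: algebra_simps)
    then show ?thesis by blast
  qed
  have "continuous_on (ball 0 r) Q" unfolding Q_def
    by (intro continuous_intros holomorphic_on_imp_continuous_on Pr h)
  then have conn: "connected (Q ` ball 0 r)"
    by (intro connected_continuous_image) auto
  have cnt: "countable (Q ` ball 0 r)"
    by (rule countable_subset[of _ "range (\<lambda>n. exp (of_real a * (of_real (2 * of_int n * pi) * \<i>)))"])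
      (use Q in auto)
  have c: "Q t = Q 0" if "t \<in> ball 0 r" for t
    using connected_uncountable[OF conn, of "Q t" "Q 0"] cnt that r(1) by auto
  define c where "c = Q 0"
  have Peq: "P t = c * exp (of_real a * h t)" if "t \<in> ball 0 r" for t
    using c[OF that] unfolding c_def[symmetric] by (auto simp: Q_def exp_minus field_simps)
  have h0: "(h has_field_derivative deriv h 0) (at 0)"
    using h r by (intro holomorphic_derivI[of h "ball 0 r"]) auto
  have "((\<lambda>t. c * exp (of_real a * h t)) has_field_derivative
          c * (exp (of_real a * h 0) * (of_real a * deriv h 0))) (at 0)"
    by (auto intro!: derivative_eq_intros h0)
  then have "(P has_field_derivative c * (exp (of_real a * h 0) * (of_real a * deriv h 0))) (at 0)"
    by (rule has_field_derivative_transform_within_open[of _ _ _ "ball 0 r"]) (use r Peq in auto)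
  then have "deriv P 0 = of_real a * deriv h 0 * P 0"
    using Peq[of 0] r by (auto dest!: DERIV_imp_deriv)
  moreover have "((\<lambda>t. exp (h t)) has_field_derivative exp (h 0) * deriv h 0) (at 0)"
    by (auto intro!: derivative_eq_intros h0)
  then have "(F has_field_derivative exp (h 0) * deriv h 0) (at 0)"
    by (rule has_field_derivative_transform_within_open[of _ _ _ "ball 0 r"]) (use r h in auto)
  then have "deriv F 0 = F 0 * deriv h 0"
    using h r by (auto dest!: DERIV_imp_deriv)
  ultimately show ?thesis by simp
qed

section \<open>Hilbert spaces of functions\<close>

locale function_hilbert =
  fixes X :: "'x set" and H :: "('x \<Rightarrow> complex) set"
    and ip :: "('x \<Rightarrow> complex) \<Rightarrow> ('x \<Rightarrow> complex) \<Rightarrow> complex"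
  assumes hilbert: "function_hilbert_space X H ip"
begin

definition nrm :: "('x \<Rightarrow> complex) \<Rightarrow> real" where
  "nrm f = sqrt (Re (ip f f))"

lemma add_mem: "f \<in> H \<Longrightarrow> g \<in> H \<Longrightarrow> (\<lambda>x. f x + g x) \<in> H"
  and scale_mem: "f \<in> H \<Longrightarrow> (\<lambda>x. c * f x) \<in> H"
  and ip_add_left: "f \<in> H \<Longrightarrow> g \<in> H \<Longrightarrow> h \<in> H \<Longrightarrow> ip (\<lambda>x. f x + g x) h = ip f h + ip g h"
  and ip_scale_left: "f \<in> H \<Longrightarrow> h \<in> H \<Longrightarrow> ip (\<lambda>x. c * f x) h = c * ip f h"
  and ip_cnj: "f \<in> H \<Longrightarrow> g \<in> H \<Longrightarrow> ip g f = cnj (ip f g)"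
  and ip_self_nonneg: "f \<in> H \<Longrightarrow> ip f f \<in> \<real>\<^sub>\<ge>\<^sub>0"
  and ip_self_zero: "f \<in> H \<Longrightarrow> ip f f = 0 \<Longrightarrow> f = (\<lambda>x. 0)"
  using hilbert unfolding function_hilbert_space_def by blast+

lemma complete:
  assumes "\<And>n::nat. s n \<in> H"
    and "\<And>e. e > 0 \<Longrightarrow> \<exists>N. \<forall>m\<ge>N. \<forall>n\<ge>N. nrm (\<lambda>x. s m x - s n x) < e"
  obtains f where "f \<in> H" "(\<lambda>n. nrm (\<lambda>x. s n x - f x)) \<longlonglongrightarrow> 0"
  using hilbert assms unfolding function_hilbert_space_def nrm_def by blast

lemma diff_mem: "f \<in> H \<Longrightarrow> g \<in> H \<Longrightarrow> (\<lambda>x. f x - g x) \<in> H"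
  using add_mem[of f "\<lambda>x. (-1) * g x"] scale_mem[of g "-1"] by simp

lemma ip_diff_left: "f \<in> H \<Longrightarrow> g \<in> H \<Longrightarrow> h \<in> H \<Longrightarrow> ip (\<lambda>x. f x - g x) h = ip f h - ip g h"
  using ip_add_left[of f "\<lambda>x. (-1) * g x" h] scale_mem[of g "-1"] ip_scale_left[of g h "-1"] by simp

lemma ip_add_right: "f \<in> H \<Longrightarrow> g \<in> H \<Longrightarrow> h \<in> H \<Longrightarrow> ip h (\<lambda>x. f x + g x) = ip h f + ip h g"
  using ip_cnj[of "\<lambda>x. f x + g x" h] ip_cnj[of f h] ip_cnj[of g h] by (simp add: add_mem ip_add_left)

lemma ip_diff_right: "f \<in> H \<Longrightarrow> g \<in> H \<Longrightarrow> h \<in> H \<Longrightarrow> ip h (\<lambda>x. f x - g x) = ip h f - ip h g"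
  using ip_cnj[of "\<lambda>x. f x - g x" h] ip_cnj[of f h] ip_cnj[of g h] by (simp add: diff_mem ip_diff_left)

lemma ip_scale_right: "f \<in> H \<Longrightarrow> h \<in> H \<Longrightarrow> ip h (\<lambda>x. c * f x) = cnj c * ip h f"
  using ip_cnj[of "\<lambda>x. c * f x" h] ip_cnj[of f h] by (simp add: scale_mem ip_scale_left)

lemma nrm_nonneg: "f \<in> H \<Longrightarrow> nrm f \<ge> 0"
  using ip_self_nonneg[of f] by (auto simp: nrm_def complex_nonneg_Reals_iff)

lemma ip_self: "f \<in> H \<Longrightarrow> ip f f = complex_of_real ((nrm f)\<^sup>2)"
  using ip_self_nonneg[of f] by (auto simp: nrm_def complex_nonneg_Reals_iff complex_eq_iff)

lemma ip_zero_right: "h \<in> H \<Longrightarrow> ip h (\<lambda>x. 0) = 0"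
  using ip_scale_right[of h h 0] by simp

lemma cauchy_schwarz:
  assumes "f \<in> H" "g \<in> H"
  shows "cmod (ip f g) \<le> nrm f * nrm g"
proof (cases "nrm g = 0")
  case True
  then have "g = (\<lambda>x. 0)" using ip_self_zero[of g] ip_self[of g] assms by simp
  then show ?thesis using ip_zero_right[of f] assms True by simp
next
  case False
  define b where "b = (nrm g)\<^sup>2"
  have b: "b > 0" using False by (simp add: b_def)
  define c where "c = ip f g / of_real b"
  define h where "h = (\<lambda>x. f x - c * g x)"
  have cg: "(\<lambda>x. c * g x) \<in> H" using scale_mem[of g c] assms by simp
  have h: "h \<in> H" unfolding h_def by (rule diff_mem) (use assms cg in auto)
  have gg: "ip g g = of_real b" using ip_self[of g] assms by (simp add: b_def)
  have gf: "ip g f = cnj (ip f g)" using ip_cnj assms by blast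
  have hg: "ip h g = 0"
    unfolding h_def ip_diff_left[OF assms(1) cg assms(2)] ip_scale_left[OF assms(2,2)] gg
    using b by (simp add: c_def)
  have "ip h h = ip h f - ip h (\<lambda>x. c * g x)"
    using ip_diff_right[OF assms(1) cg h] by (simp add: h_def)
  also have "\<dots> = ip h f"
    using ip_scale_right[OF assms(2) h] hg by simp
  also have "\<dots> = ip f f - c * ip g f"
    unfolding h_def using ip_diff_left[OF assms(1) cg assms(1)] ip_scale_left[OF assms(2,1)] by simp
  also have "c * ip g f = of_real ((cmod (ip f g))\<^sup>2 / b)"
    using b by (simp add: c_def gf complex_norm_square[symmetric] del: of_real_power)
  finally have "of_real ((nrm h)\<^sup>2) = complex_of_real ((nrm f)\<^sup>2 - (cmod (ip f g))\<^sup>2 / b)"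
    using ip_self[OF h] ip_self[OF assms(1)] by simp
  then have "(nrm f)\<^sup>2 - (cmod (ip f g))\<^sup>2 / b = (nrm h)\<^sup>2" by (simp only: of_real_eq_iff)
  then have "(nrm f)\<^sup>2 - (cmod (ip f g))\<^sup>2 / b \<ge> 0" by simp
  then have "(cmod (ip f g))\<^sup>2 \<le> (nrm f * nrm g)\<^sup>2"
    using b by (simp add: field_simps b_def)
  then show ?thesis
    by (rule power2_le_imp_le) (simp add: nrm_nonneg assms)
qed

lemma nrm_triangle:
  assumes "f \<in> H" "g \<in> H"
  shows "nrm (\<lambda>x. f x + g x) \<le> nrm f + nrm g"
proof (rule power2_le_imp_le)
  let ?s = "\<lambda>x. f x + g x"
  have s: "?s \<in> H" using add_mem assms by blast
  have "complex_of_real ((nrm ?s)\<^sup>2) = ip f f + ip g g + (ip f g + ip g f)"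
    using ip_self[OF s] ip_add_left[OF assms s] ip_add_right[OF assms assms(1)]
      ip_add_right[OF assms assms(2)] by (simp add: algebra_simps)
  then have "(nrm ?s)\<^sup>2 = Re (ip f f + ip g g + (ip f g + ip g f))"
    by (metis Re_complex_of_real)
  also have "\<dots> = (nrm f)\<^sup>2 + (nrm g)\<^sup>2 + 2 * Re (ip f g)"
    using ip_cnj[OF assms] ip_self assms by simp
  also have "\<dots> \<le> (nrm f)\<^sup>2 + (nrm g)\<^sup>2 + 2 * (nrm f * nrm g)"
    using cauchy_schwarz[OF assms] complex_Re_le_cmod[of "ip f g"] by linarith
  finally show "(nrm ?s)\<^sup>2 \<le> (nrm f + nrm g)\<^sup>2" by (simp add: power2_eq_square algebra_simps)
  show "0 \<le> nrm f + nrm g" using nrm_nonneg assms by simp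
qed

lemma nrm_diff_triangle:
  assumes "f \<in> H" "g \<in> H" "h \<in> H"
  shows "nrm (\<lambda>x. f x - h x) \<le> nrm (\<lambda>x. f x - g x) + nrm (\<lambda>x. g x - h x)"
  using nrm_triangle[OF diff_mem[OF assms(1,2)] diff_mem[OF assms(2,3)]] by simp

lemma ip_tendsto:
  assumes F: "\<forall>\<^sub>F a in A. F a \<in> H" "((\<lambda>a. nrm (\<lambda>x. F a x - f x)) \<longlongrightarrow> 0) A" "f \<in> H"
    and G: "\<forall>\<^sub>F a in A. G a \<in> H" "((\<lambda>a. nrm (\<lambda>x. G a x - g x)) \<longlongrightarrow> 0) A" "g \<in> H"
  shows "((\<lambda>a. ip (F a) (G a)) \<longlongrightarrow> ip f g) A"
proof -
  let ?u = "\<lambda>a. nrm (\<lambda>x. F a x - f x)" and ?v = "\<lambda>a. nrm (\<lambda>x. G a x - g x)"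
  have "\<forall>\<^sub>F a in A. cmod (ip (F a) (G a) - ip f g) \<le> ?u a * (?v a + nrm g) + nrm f * ?v a"
    using F(1) G(1)
  proof eventually_elim
    case (elim a)
    note dF = diff_mem[OF elim(1) F(3)] and dG = diff_mem[OF elim(2) G(3)]
    have Ga: "nrm (G a) \<le> ?v a + nrm g" using nrm_triangle[OF dG G(3)] by simp
    have "ip (F a) (G a) - ip f g = ip (\<lambda>x. F a x - f x) (G a) + ip f (\<lambda>x. G a x - g x)"
      using ip_diff_left[OF elim(1) F(3) elim(2)] ip_diff_right[OF elim(2) G(3) F(3)] by simp
    then have "cmod (ip (F a) (G a) - ip f g) \<le>
        cmod (ip (\<lambda>x. F a x - f x) (G a)) + cmod (ip f (\<lambda>x. G a x - g x))"
      by (simp add: norm_triangle_ineq)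
    moreover have "cmod (ip (\<lambda>x. F a x - f x) (G a)) \<le> ?u a * nrm (G a)"
      by (rule cauchy_schwarz[OF dF elim(2)])
    moreover have "?u a * nrm (G a) \<le> ?u a * (?v a + nrm g)"
      by (rule mult_left_mono[OF Ga nrm_nonneg[OF dF]])
    moreover have "cmod (ip f (\<lambda>x. G a x - g x)) \<le> nrm f * ?v a"
      by (rule cauchy_schwarz[OF F(3) dG])
    ultimately show ?case by linarith
  qed
  moreover have "((\<lambda>a. ?u a * (?v a + nrm g) + nrm f * ?v a) \<longlongrightarrow> 0 * (0 + nrm g) + nrm f * 0) A"
    by (intro tendsto_intros F G)
  then have "((\<lambda>a. ?u a * (?v a + nrm g) + nrm f * ?v a) \<longlongrightarrow> 0) A" by simp
  ultimately have "((\<lambda>a. ip (F a) (G a) - ip f g) \<longlongrightarrow> 0) A"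
    by (rule Lim_null_comparison)
  then show ?thesis by (simp add: LIM_zero_iff)
qed

lemma nrm_diff_sq:
  assumes "f \<in> H" "g \<in> H"
  shows "(nrm (\<lambda>x. f x - g x))\<^sup>2 = Re (ip f f - ip f g - ip g f + ip g g)"
proof -
  let ?d = "\<lambda>x. f x - g x"
  have d: "?d \<in> H" using diff_mem assms by blast
  have "complex_of_real ((nrm ?d)\<^sup>2) = ip f f - ip f g - ip g f + ip g g"
    using ip_self[OF d] ip_diff_left[OF assms d] ip_diff_right[OF assms assms(1)]
      ip_diff_right[OF assms assms(2)] by (simp add: algebra_simps)
  then show ?thesis by (metis Re_complex_of_real)
qed

text \<open>The squared norm of \<open>D s - D t\<close> is an alternating sum of four Gram entries, which all tend to the
  same \<open>l\<close>, so \<open>D\<close> is Cauchy at the origin.  The completeness assumption speaks of sequences only,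
  hence the passage through one sequence tending to the origin.\<close>

lemma nrm_convergent_at_zero:
  fixes D :: "complex \<Rightarrow> 'x \<Rightarrow> complex"
  assumes R: "R > 0" and D: "\<And>t. t \<in> ball 0 R \<Longrightarrow> D t \<in> H"
    and gram: "((\<lambda>(s, t). ip (D t) (D s)) \<longlongrightarrow> l) (at 0 \<times>\<^sub>F at 0)"
  obtains E where "E \<in> H" "((\<lambda>t. nrm (\<lambda>x. D t x - E x)) \<longlongrightarrow> 0) (at 0)"
proof -
  have tri: "cmod (a - b - c + d) \<le> cmod a + cmod b + cmod c + cmod d" for a b c d
    using norm_triangle_ineq[of "a - b - c" d] norm_triangle_ineq4[of "a - b" c]
      norm_triangle_ineq4[of a b] by linarith
  have cauchy: "\<exists>d>0. d \<le> R \<and> (\<forall>s t. s \<noteq> 0 \<and> t \<noteq> 0 \<and> s \<in> ball 0 d \<and> t \<in> ball 0 d \<longrightarrow>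
      nrm (\<lambda>x. D s x - D t x) < e)" if e: "e > 0" for e
  proof -
    have "\<forall>\<^sub>F p in at 0 \<times>\<^sub>F at 0. dist (case p of (s, t) \<Rightarrow> ip (D t) (D s)) l < e\<^sup>2 / 4"
      using e by (intro tendstoD[OF gram]) auto
    then obtain P Q where PQ: "eventually P (at 0)" "eventually Q (at 0)"
      "\<And>s t. P s \<Longrightarrow> Q t \<Longrightarrow> dist (ip (D t) (D s)) l < e\<^sup>2 / 4"
      unfolding eventually_prod_filter by auto
    then obtain d1 d2 where d12: "d1 > 0" "d2 > 0"
      "\<And>s. s \<noteq> 0 \<Longrightarrow> dist s 0 < d1 \<Longrightarrow> P s" "\<And>s. s \<noteq> 0 \<Longrightarrow> dist s 0 < d2 \<Longrightarrow> Q s"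
      unfolding eventually_at by auto
    define d where "d = min (min d1 d2) R"
    have d: "d > 0" "d \<le> R" using d12 R by (auto simp: d_def)
    have G: "cmod (ip (D t) (D s) - l) < e\<^sup>2 / 4"
      if "s \<noteq> 0" "t \<noteq> 0" "s \<in> ball 0 d" "t \<in> ball 0 d" for s t
      using PQ(3)[of s t] d12 that by (auto simp: d_def dist_norm)
    have "nrm (\<lambda>x. D s x - D t x) < e"
      if st: "s \<noteq> 0" "t \<noteq> 0" "s \<in> ball 0 d" "t \<in> ball 0 d" for s t
    proof (rule power2_less_imp_less)
      have DH: "D s \<in> H" "D t \<in> H" using D st d by auto
      have "(nrm (\<lambda>x. D s x - D t x))\<^sup>2 =
        Re ((ip (D s) (D s) - l) - (ip (D s) (D t) - l) - (ip (D t) (D s) - l) + (ip (D t) (D t) - l))"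
        by (subst nrm_diff_sq[OF DH]) simp
      also have "\<dots> \<le> cmod (ip (D s) (D s) - l) + cmod (ip (D s) (D t) - l)
           + cmod (ip (D t) (D s) - l) + cmod (ip (D t) (D t) - l)"
        by (rule order_trans[OF complex_Re_le_cmod tri])
      also have "\<dots> < e\<^sup>2 / 4 + e\<^sup>2 / 4 + e\<^sup>2 / 4 + e\<^sup>2 / 4"
        by (intro add_strict_mono G st)
      finally show "(nrm (\<lambda>x. D s x - D t x))\<^sup>2 < e\<^sup>2" by simp
    qed (use e in auto)
    then show ?thesis using d by blast
  qed
  define \<tau> where "\<tau> n = complex_of_real (R / (n + 2))" for n :: nat
  have \<tau>: "\<tau> n \<noteq> 0" "\<tau> n \<in> ball 0 R" for n
  proof -
    have "R / (real n + 2) < R" using R by (simp add: divide_less_eq algebra_simps add_pos_nonneg)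
    then show "\<tau> n \<noteq> 0" "\<tau> n \<in> ball 0 R" using R
      by (auto simp: \<tau>_def add.commute simp del: of_real_divide)
  qed
  have \<tau>0: "\<tau> \<longlonglongrightarrow> 0"
  proof -
    have "(\<lambda>n. R / (real n + 2)) \<longlonglongrightarrow> 0" by real_asymp
    from tendsto_of_real[OF this, where 'a = complex] show ?thesis
      by (simp add: \<tau>_def[abs_def] add.commute)
  qed
  have small: "\<exists>N. \<forall>n\<ge>N. \<tau> n \<in> ball 0 d" if "d > 0" for d
    using \<tau>0[unfolded LIMSEQ_def] that by (auto simp: dist_norm)
  obtain E where E: "E \<in> H" "(\<lambda>n. nrm (\<lambda>x. D (\<tau> n) x - E x)) \<longlonglongrightarrow> 0"
  proof (rule complete[of "\<lambda>n. D (\<tau> n)"])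
    fix e :: real assume "e > 0"
    from cauchy[OF this] obtain d where d: "d > 0" "\<And>s t. s \<noteq> 0 \<Longrightarrow> t \<noteq> 0 \<Longrightarrow> s \<in> ball 0 d \<Longrightarrow> t \<in> ball 0 d \<Longrightarrow>
      nrm (\<lambda>x. D s x - D t x) < e" by blast
    from small[OF d(1)] obtain N where "\<And>n. n \<ge> N \<Longrightarrow> \<tau> n \<in> ball 0 d" by blast
    then show "\<exists>N. \<forall>m\<ge>N. \<forall>n\<ge>N. nrm (\<lambda>x. D (\<tau> m) x - D (\<tau> n) x) < e"
      using d(2) \<tau>(1) by (intro exI[of _ N]) simp
  next
    show "D (\<tau> n) \<in> H" for n using D \<tau>(2) by blast
  qed
  have "((\<lambda>t. nrm (\<lambda>x. D t x - E x)) \<longlongrightarrow> 0) (at 0)"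
  proof (rule tendstoI)
    fix e :: real assume e: "e > 0"
    then have e2: "e / 2 > 0" by simp
    from cauchy[OF this] obtain d where d: "d > 0" "d \<le> R"
      "\<And>s t. s \<noteq> 0 \<Longrightarrow> t \<noteq> 0 \<Longrightarrow> s \<in> ball 0 d \<Longrightarrow> t \<in> ball 0 d \<Longrightarrow>
      nrm (\<lambda>x. D s x - D t x) < e / 2" by blast
    from small[OF d(1)] obtain N where N: "\<And>n. n \<ge> N \<Longrightarrow> \<tau> n \<in> ball 0 d" by blast
    from E(2)[unfolded LIMSEQ_def, rule_format, OF e2] obtain M where
      M: "\<And>n. n \<ge> M \<Longrightarrow> nrm (\<lambda>x. D (\<tau> n) x - E x) < e / 2"
      by (metis abs_le_D1 diff_zero dist_norm le_less_trans order_refl real_norm_def)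
    define n where "n = max N M"
    have "nrm (\<lambda>x. D t x - E x) < e \<and> nrm (\<lambda>x. D t x - E x) \<ge> 0" if "t \<noteq> 0" "t \<in> ball 0 d" for t
    proof -
      have tH: "D t \<in> H" "D (\<tau> n) \<in> H" using D that d \<tau> by auto
      have "nrm (\<lambda>x. D t x - D (\<tau> n) x) < e / 2"
        by (rule d(3)) (use that N \<tau> in \<open>auto simp: n_def\<close>)
      moreover have "nrm (\<lambda>x. D (\<tau> n) x - E x) < e / 2" by (rule M) (simp add: n_def)
      ultimately show ?thesis using nrm_diff_triangle[OF tH E(1)] nrm_nonneg[OF diff_mem[OF tH(1) E(1)]]
        by simp
    qed
    then show "\<forall>\<^sub>F t in at 0. dist (nrm (\<lambda>x. D t x - E x)) 0 < e"
      unfolding eventually_at using d(1) by (intro exI[of _ d]) (auto simp: dist_norm)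
  qed
  with E(1) show thesis by (rule that)
qed

end

section \<open>Sesqui-analytic functions\<close>

lemma bounded_linear_scalar_mult: "bounded_linear (\<lambda>s::complex. s *s (v :: complex^'m))"
proof -
  have "linear (\<lambda>s::complex. s *s v)"
    by (rule linearI) (simp_all add: vec_eq_iff algebra_simps)
  then show ?thesis by (rule linear_conv_bounded_linear[THEN iffD1])
qed

lemma line_has_derivative:
  "((\<lambda>s. z + s *s v) has_derivative (\<lambda>s. s *s v)) (at s0)" for v :: "complex^'m"
  using has_derivative_add[OF has_derivative_const bounded_linear_imp_has_derivative[OF bounded_linear_scalar_mult]]
  by simp

lemma cnj_line_has_derivative:
  "((\<lambda>s. z + cnj s *s v) has_derivative (\<lambda>s. cnj s *s v)) (at s0)" for v :: "complex^'m"
  using has_derivative_add[OF has_derivative_const bounded_linear_imp_has_derivative[OF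
      bounded_linear_compose[OF bounded_linear_scalar_mult bounded_linear_cnj]]]
  by simp

lemma continuous_on_line [continuous_intros]:
  "continuous_on S f \<Longrightarrow> continuous_on S (\<lambda>s. z + f s *s v)" for v :: "complex^'m"
  using bounded_linear.continuous_on[OF bounded_linear_scalar_mult[of v], of S f]
  by (intro continuous_intros)

lemma line_stays_in_open:
  fixes z v :: "complex^'m"
  assumes "open W" "z \<in> W"
  shows "\<exists>R>0. \<forall>s\<in>ball 0 R. z + s *s v \<in> W"
proof -
  have "open ((\<lambda>s. z + s *s v) -` W)"
    by (rule open_vimage[OF assms(1)]) (intro continuous_intros)
  moreover have "0 \<in> (\<lambda>s. z + s *s v) -` W" using assms by simp
  ultimately obtain R where "R > 0" "ball 0 R \<subseteq> (\<lambda>s. z + s *s v) -` W"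
    using openE by blast
  then show ?thesis by blast
qed

lemma sesqui_analytic_left:
  assumes P: "sesqui_analytic_on W P" and S: "open S" "\<And>s. s \<in> S \<Longrightarrow> z + s *s v \<in> W" and w: "w \<in> W"
  shows "(\<lambda>s. P (z + s *s v) w) holomorphic_on S"
  unfolding holomorphic_on_open[OF S(1)]
proof
  fix s assume s: "s \<in> S"
  obtain D where D: "((\<lambda>p. P (fst p) (snd p)) has_derivative D) (at (z + s *s v, w))"
    "\<And>c v. D (c *s v, 0) = c * D (v, 0)"
    using P S(2)[OF s] w unfolding sesqui_analytic_on_def by blast
  have "((\<lambda>s. (z + s *s v, w)) has_derivative (\<lambda>s. (s *s v, 0))) (at s)"
    by (intro has_derivative_Pair line_has_derivative has_derivative_const)
  from has_derivative_compose[OF this D(1)]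
  have "((\<lambda>s. P (z + s *s v) w) has_derivative (\<lambda>s. D (v, 0) * s)) (at s)"
    by (simp add: D(2) mult.commute)
  then show "\<exists>f'. ((\<lambda>s. P (z + s *s v) w) has_field_derivative f') (at s)"
    unfolding has_field_derivative_def by blast
qed

lemma sesqui_analytic_right:
  assumes P: "sesqui_analytic_on W P" and S: "open S" "\<And>t. t \<in> S \<Longrightarrow> w + cnj t *s v \<in> W" and z: "z \<in> W"
  shows "(\<lambda>t. P z (w + cnj t *s v)) holomorphic_on S"
  unfolding holomorphic_on_open[OF S(1)]
proof
  fix s assume s: "s \<in> S"
  obtain D where D: "((\<lambda>p. P (fst p) (snd p)) has_derivative D) (at (z, w + cnj s *s v))"
    "\<And>c v. D (0, c *s v) = cnj c * D (0, v)"
    using P S(2)[OF s] z unfolding sesqui_analytic_on_def by blast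
  have "((\<lambda>s. (z, w + cnj s *s v)) has_derivative (\<lambda>s. (0, cnj s *s v))) (at s)"
    by (intro has_derivative_Pair cnj_line_has_derivative has_derivative_const)
  from has_derivative_compose[OF this D(1)]
  have "((\<lambda>s. P z (w + cnj s *s v)) has_derivative (\<lambda>s. D (0, v) * s)) (at s)"
    by (simp add: D(2) mult.commute)
  then show "\<exists>f'. ((\<lambda>s. P z (w + cnj s *s v)) has_field_derivative f') (at s)"
    unfolding has_field_derivative_def by blast
qed

lemma sesqui_analytic_continuous:
  assumes "sesqui_analytic_on W P"
  shows "continuous_on (W \<times> W) (\<lambda>p. P (fst p) (snd p))"
proof (rule continuous_at_imp_continuous_on, rule ballI)
  fix p assume "p \<in> W \<times> W"
  then obtain D where "((\<lambda>p. P (fst p) (snd p)) has_derivative D) (at p)"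
    using assms unfolding sesqui_analytic_on_def by force
  then show "isCont (\<lambda>p. P (fst p) (snd p)) p" by (rule has_derivative_continuous)
qed

text \<open>Continuity on a compact bidisc supplies the bound that the one-variable estimates need.\<close>

lemma sesqui_analytic_bounded_on_bidisc:
  assumes P: "sesqui_analytic_on W P" and S: "\<And>s. s \<in> cball 0 r \<Longrightarrow> z + s *s v \<in> W"
    and T: "\<And>t. t \<in> cball 0 r \<Longrightarrow> w + t *s u \<in> W"
  shows "\<exists>M. \<forall>s\<in>cball 0 r. \<forall>t\<in>cball 0 r. cmod (P (z + s *s v) (w + cnj t *s u)) \<le> M"
proof -
  let ?c = "\<lambda>q. (z + fst q *s v, w + cnj (snd q) *s u)"
  have "continuous_on (cball 0 r \<times> cball 0 r) ((\<lambda>p. P (fst p) (snd p)) \<circ> ?c)"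
  proof (rule continuous_on_compose)
    show "continuous_on (cball 0 r \<times> cball 0 r) ?c" by (intro continuous_intros)
    show "continuous_on (?c ` (cball 0 r \<times> cball 0 r)) (\<lambda>p. P (fst p) (snd p))"
      by (rule continuous_on_subset[OF sesqui_analytic_continuous[OF P]]) (use S T in auto)
  qed
  then have "compact (((\<lambda>p. P (fst p) (snd p)) \<circ> ?c) ` (cball 0 r \<times> cball 0 r))"
    by (intro compact_continuous_image compact_Times compact_cball)
  then obtain M where "\<forall>y \<in> ((\<lambda>p. P (fst p) (snd p)) \<circ> ?c) ` (cball 0 r \<times> cball 0 r). cmod y \<le> M"
    using compact_imp_bounded bounded_iff by blast
  then show ?thesis by (intro exI[of _ M]) force
qed

text \<open>Precomposing with the conjugation makes an anti-holomorphic function holomorphic, so that the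
  derivative in the direction \<open>v\<close> with respect to the conjugate variables becomes an ordinary complex
  derivative.  The direction \<open>v = 0\<close> occurs when only one point of a pair moves.\<close>

definition conj_deriv ::
    "complex^'m \<Rightarrow> (complex^'m \<Rightarrow> complex^'m \<Rightarrow> complex) \<Rightarrow> complex^'m \<Rightarrow> complex^'m \<Rightarrow> complex" where
  "conj_deriv v P z w = deriv (\<lambda>t. P z (w + cnj t *s v)) 0"

lemma has_conj_deriv:
  assumes P: "sesqui_analytic_on W P" and W: "open W" "z \<in> W" "w \<in> W"
  shows "((\<lambda>t. P z (w + cnj t *s v)) has_field_derivative conj_deriv v P z w) (at 0)"
proof -
  obtain R where R: "R > 0" "\<And>s. s \<in> ball 0 R \<Longrightarrow> w + s *s v \<in> W"
    using line_stays_in_open[OF W(1,3)] by blast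
  have "(\<lambda>t. P z (w + cnj t *s v)) holomorphic_on ball 0 R"
    by (rule sesqui_analytic_right[OF P]) (use R W in auto)
  then show ?thesis unfolding conj_deriv_def using R
    by (intro holomorphic_derivI[of _ "ball 0 R"]) auto
qed

lemma conj_deriv_zero [simp]: "conj_deriv 0 P z w = 0"
  by (simp add: conj_deriv_def)

lemma partial_bar_eq_conj_deriv:
  assumes P: "sesqui_analytic_on W P" and W: "open W" "z \<in> W" "w \<in> W"
  shows "partial_bar j (P z) w = conj_deriv (axis j 1) P z w"
proof -
  have "((\<lambda>t. P z (w + cnj t *s axis j 1)) has_field_derivative conj_deriv (axis j 1) P z w) (at (cnj 0))"
    using has_conj_deriv[OF assms] by simp
  then have "((cnj \<circ> (\<lambda>t. P z (w + cnj t *s axis j 1)) \<circ> cnj) has_field_derivative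
      cnj (conj_deriv (axis j 1) P z w)) (at 0)"
    by (rule has_field_derivative_cnj_cnj)
  then show ?thesis by (simp add: partial_bar_def o_def DERIV_imp_deriv)
qed

lemma conj_deriv_power:
  assumes K: "sesqui_analytic_on W K" and P: "kernel_power_on W K a P"
    and W: "open W" "z \<in> W" "w \<in> W"
  shows "conj_deriv v P z w * K z w = of_real a * conj_deriv v K z w * P z w"
proof -
  obtain R where R: "R > 0" "\<And>s. s \<in> ball 0 R \<Longrightarrow> w + s *s v \<in> W"
    using line_stays_in_open[OF W(1,3)] by blast
  have Ps: "sesqui_analytic_on W P" using P by (simp add: kernel_power_on_def)
  have "deriv (\<lambda>t. P z (w + cnj t *s v)) 0 * K z (w + cnj 0 *s v) =
    of_real a * deriv (\<lambda>t. K z (w + cnj t *s v)) 0 * P z (w + cnj 0 *s v)"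
  proof (rule deriv_power_branch[where R = R])
    show "(\<lambda>t. K z (w + cnj t *s v)) holomorphic_on ball 0 R"
      "(\<lambda>t. P z (w + cnj t *s v)) holomorphic_on ball 0 R"
      by (rule sesqui_analytic_right[OF K] sesqui_analytic_right[OF Ps]; use R W in auto)+
    fix t :: complex assume "t \<in> ball 0 R"
    then have "w + cnj t *s v \<in> W" using R(2)[of "cnj t"] by simp
    then show "if K z (w + cnj t *s v) = 0 then P z (w + cnj t *s v) = 0
      else \<exists>l. exp l = K z (w + cnj t *s v) \<and> P z (w + cnj t *s v) = exp (of_real a * l)"
      using P W unfolding kernel_power_on_def by blast
  qed (use R in auto)
  then show ?thesis by (simp add: conj_deriv_def)
qed

lemma conj_deriv_log:
  assumes L: "sesqui_analytic_on W L" and W: "open W" "z \<in> W" "w \<in> W"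
    and e: "\<And>w. w \<in> W \<Longrightarrow> exp (L z w) = K z w"
  shows "conj_deriv v K z w = conj_deriv v L z w * K z w"
proof -
  obtain R where R: "R > 0" "\<And>s. s \<in> ball 0 R \<Longrightarrow> w + s *s v \<in> W"
    using line_stays_in_open[OF W(1,3)] by blast
  have "((\<lambda>t. exp (L z (w + cnj t *s v))) has_field_derivative exp (L z (w + cnj 0 *s v)) * conj_deriv v L z w) (at 0)"
    by (auto intro!: derivative_eq_intros has_conj_deriv[OF L W])
  then have "((\<lambda>t. K z (w + cnj t *s v)) has_field_derivative exp (L z (w + cnj 0 *s v)) * conj_deriv v L z w) (at 0)"
  proof (rule has_field_derivative_transform_within_open[of _ _ _ "ball 0 R"])
    fix t :: complex assume "t \<in> ball 0 R"
    then show "exp (L z (w + cnj t *s v)) = K z (w + cnj t *s v)" using R(2)[of "cnj t"] e by simp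
  qed (use R in auto)
  then show ?thesis using e[OF W(3)] by (simp add: conj_deriv_def DERIV_imp_deriv)
qed

text \<open>The derivative in the conjugate variable depends holomorphically on the first point, by
  holomorphy of derivatives with respect to a parameter; so the outer derivative exists.\<close>

lemma conj_deriv_tendsto_mixed_partial:
  fixes z :: "complex^'m"
  assumes L: "sesqui_analytic_on W L" and W: "open W" "z \<in> W"
  shows "((\<lambda>s. (conj_deriv (axis j 1) L (z + s *s axis i 1) z - conj_deriv (axis j 1) L z z) / s)
           \<longlongrightarrow> mixed_partial i j L z z) (at 0)"
proof -
  let ?i = "axis i 1 :: complex^'m" and ?j = "axis j 1 :: complex^'m"
  obtain R1 R2 where R12: "R1 > 0" "\<And>s. s \<in> ball 0 R1 \<Longrightarrow> z + s *s ?i \<in> W"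
    "R2 > 0" "\<And>s. s \<in> ball 0 R2 \<Longrightarrow> z + s *s ?j \<in> W"
    using line_stays_in_open[OF W] by metis
  define R where "R = min R1 R2"
  define r where "r = R / 2"
  have R: "R > 0" "\<And>s. s \<in> ball 0 R \<Longrightarrow> z + s *s ?i \<in> W" "\<And>s. s \<in> ball 0 R \<Longrightarrow> z + s *s ?j \<in> W"
    using R12 by (auto simp: R_def)
  have r: "0 < r" "r < R" "cball 0 r \<subseteq> ball (0::complex) R" using R(1) by (auto simp: r_def)
  obtain M where M: "\<And>s t. s \<in> cball 0 r \<Longrightarrow> t \<in> cball 0 r \<Longrightarrow> cmod (L (z + s *s ?i) (z + cnj t *s ?j)) \<le> M"
    using sesqui_analytic_bounded_on_bidisc[OF L, of r z ?i z ?j] R r by blast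
  let ?g = "\<lambda>s. deriv (\<lambda>t. L (z + s *s ?i) (z + cnj t *s ?j)) 0"
  have g: "?g holomorphic_on ball 0 r"
  proof (rule holomorphic_on_parameter_deriv[where R = R and M = M])
    show "(\<lambda>t. L (z + s *s ?i) (z + cnj t *s ?j)) holomorphic_on ball 0 R" if "s \<in> ball 0 R" for s
      by (rule sesqui_analytic_right[OF L]) (use R that in auto)
    show "(\<lambda>s. L (z + s *s ?i) (z + cnj t *s ?j)) holomorphic_on ball 0 R" if "t \<in> ball 0 R" for t
      by (rule sesqui_analytic_left[OF L]) (use R that in auto)
  qed (use r M in auto)
  have eq: "partial_bar j (L (z + s *s ?i)) z = ?g s" if "s \<in> ball 0 r" for s
    using partial_bar_eq_conj_deriv[OF L W(1) _ W(2), of "z + s *s ?i" j] R(2)[of s] r(2) that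
    by (simp add: conj_deriv_def)
  have "mixed_partial i j L z z = deriv ?g 0"
    unfolding mixed_partial_def partial_def
  proof (rule deriv_cong_ev)
    show "\<forall>\<^sub>F s in nhds 0. partial_bar j (L (z + s *s ?i)) z = ?g s"
      using eq r(1) by (auto simp: eventually_nhds intro!: exI[of _ "ball 0 r"])
  qed simp
  then show ?thesis using diff_quot_tendsto[OF g r(1)] by (simp add: conj_deriv_def)
qed

section \<open>Derivatives of reproducing kernels\<close>

locale kernel_hilbert = function_hilbert X H ip
  for X :: "'x set" and H ip +
  fixes k :: "'x \<Rightarrow> 'x \<Rightarrow> complex"
  assumes reproducing: "reproducing_kernel X H ip k"
begin

abbreviation sec :: "'x \<Rightarrow> 'x \<Rightarrow> complex" where
  "sec \<equiv> kernel_section X k"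

lemma sec_mem: "y \<in> X \<Longrightarrow> sec y \<in> H"
  and ip_sec: "f \<in> H \<Longrightarrow> y \<in> X \<Longrightarrow> ip f (sec y) = f y"
  and sec_apply: "x \<in> X \<Longrightarrow> sec y x = k x y"
  using reproducing unfolding reproducing_kernel_def by (auto simp: kernel_section_def)

text \<open>The sections of a sesqui-analytic kernel depend anti-holomorphically on the point, which is why the increment is
  divided by the conjugate of \<open>t\<close>.  Pairing with a function then gives its ordinary difference
  quotient along \<open>c\<close>.\<close>

definition sec_quot :: "(complex \<Rightarrow> 'x) \<Rightarrow> complex \<Rightarrow> 'x \<Rightarrow> complex" where
  "sec_quot c t = (\<lambda>x. (1 / cnj t) * (sec (c t) x - sec (c 0) x))"

lemma sec_quot_mem: "c t \<in> X \<Longrightarrow> c 0 \<in> X \<Longrightarrow> sec_quot c t \<in> H"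
  unfolding sec_quot_def by (intro scale_mem diff_mem sec_mem)

lemma ip_sec_quot:
  assumes "f \<in> H" "c t \<in> X" "c 0 \<in> X"
  shows "ip f (sec_quot c t) = (f (c t) - f (c 0)) / t"
proof -
  note m = sec_mem[OF assms(2)] sec_mem[OF assms(3)]
  show ?thesis
    unfolding sec_quot_def ip_scale_right[OF diff_mem[OF m] assms(1)] ip_diff_right[OF m assms(1)]
    using assms by (simp add: ip_sec)
qed

text \<open>The Gram matrix of the difference quotients consists of second difference quotients of the kernel
  along the curve, and these converge.  So the quotients converge in norm to a vector that represents
  differentiation along \<open>c\<close>, and evaluating this vector differentiates the kernel in its second
  argument.\<close>

lemma kernel_derivative_representer:
  fixes c :: "complex \<Rightarrow> 'x"
  assumes r: "0 < r" "r < R" and c: "\<And>t. t \<in> ball 0 R \<Longrightarrow> c t \<in> X"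
    and hol1: "\<And>t. t \<in> ball 0 R \<Longrightarrow> (\<lambda>s. k (c s) (c (cnj t))) holomorphic_on ball 0 R"
    and hol2: "\<And>s. s \<in> ball 0 R \<Longrightarrow> (\<lambda>t. k (c s) (c (cnj t))) holomorphic_on ball 0 R"
    and bd: "\<And>s t. s \<in> cball 0 r \<Longrightarrow> t \<in> cball 0 r \<Longrightarrow> cmod (k (c s) (c (cnj t))) \<le> M"
  obtains E where "E \<in> H" "((\<lambda>t. nrm (\<lambda>x. sec_quot c t x - E x)) \<longlongrightarrow> 0) (at 0)"
    "\<And>f. f \<in> H \<Longrightarrow> ((\<lambda>t. (f (c t) - f (c 0)) / t) \<longlongrightarrow> ip f E) (at 0)"
    "\<And>x. x \<in> X \<Longrightarrow> ((\<lambda>t. (k x (c (cnj t)) - k x (c 0)) / t) \<longlongrightarrow> E x) (at 0)"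
proof -
  define \<phi> where "\<phi> s t = k (c s) (c (cnj t))" for s t
  have R: "R > 0" using r by simp
  have c0: "c 0 \<in> X" using c[of 0] R by simp
  have DH: "sec_quot c t \<in> H" if "t \<in> ball 0 R" for t
    using sec_quot_mem c that c0 by blast
  have evR: "\<forall>\<^sub>F t in at 0. t \<in> ball (0::complex) R"
    using R by (auto simp: eventually_at dist_norm intro!: exI[of _ R])
  obtain l where l: "((\<lambda>(s, t). (\<phi> s t - \<phi> 0 t - \<phi> s 0 + \<phi> 0 0) / (s * t)) \<longlongrightarrow> l) (at 0 \<times>\<^sub>F at 0)"
    using second_diff_quot_tendsto[of r R \<phi> M] r hol1 hol2 bd unfolding \<phi>_def by blast
  \<comment> \<open>The Gram entry at (s, t) is the second difference quotient at (s, cnj t).\<close>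
  have cnj0: "filterlim cnj (at 0) (at 0)"
    by (rule filterlim_atI) (auto intro!: tendsto_eq_intros simp: eventually_at intro: exI[of _ 1])
  have "filterlim (\<lambda>p. (fst p, cnj (snd p))) (at 0 \<times>\<^sub>F at 0) (at 0 \<times>\<^sub>F at (0::complex))"
    by (intro filterlim_Pair filterlim_fst filterlim_compose[OF cnj0] filterlim_snd)
  from filterlim_compose[OF l this]
  have "((\<lambda>p. (\<phi> (fst p) (cnj (snd p)) - \<phi> 0 (cnj (snd p)) - \<phi> (fst p) 0 + \<phi> 0 0) / (fst p * cnj (snd p)))
      \<longlongrightarrow> l) (at 0 \<times>\<^sub>F at 0)" by simp
  moreover have "\<forall>\<^sub>F p in at 0 \<times>\<^sub>F at 0. (\<phi> (fst p) (cnj (snd p)) - \<phi> 0 (cnj (snd p)) - \<phi> (fst p) 0 + \<phi> 0 0) / (fst p * cnj (snd p))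
      = (\<lambda>(s, t). ip (sec_quot c t) (sec_quot c s)) p"
  proof -
    have "\<forall>\<^sub>F p in at 0 \<times>\<^sub>F at (0::complex). fst p \<in> ball (0::complex) R \<and> snd p \<in> ball 0 R"
      using evR by (auto simp: eventually_prod_filter)
    then show ?thesis
    proof eventually_elim
      case (elim p)
      obtain s t where p: "p = (s, t)" by force
      have st: "c s \<in> X" "c t \<in> X" and t: "t \<in> ball 0 R" using elim c by (auto simp: p)
      have "ip (sec_quot c t) (sec_quot c s) = (sec_quot c t (c s) - sec_quot c t (c 0)) / s"
        by (rule ip_sec_quot[OF DH[OF t] st(1) c0])
      also have "\<dots> = (1 / cnj t * (k (c s) (c t) - k (c s) (c 0)) - 1 / cnj t * (k (c 0) (c t) - k (c 0) (c 0))) / s"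
        using st c0 by (simp add: sec_quot_def sec_apply)
      also have "\<dots> = (\<phi> s (cnj t) - \<phi> 0 (cnj t) - \<phi> s 0 + \<phi> 0 0) / (s * cnj t)"
        by (cases "s = 0 \<or> t = 0") (auto simp: \<phi>_def divide_simps algebra_simps)
      finally show ?case by (simp add: p)
    qed
  qed
  ultimately have gram: "((\<lambda>(s, t). ip (sec_quot c t) (sec_quot c s)) \<longlongrightarrow> l) (at 0 \<times>\<^sub>F at 0)"
    by (rule Lim_transform_eventually)
  obtain E where E: "E \<in> H" "((\<lambda>t. nrm (\<lambda>x. sec_quot c t x - E x)) \<longlongrightarrow> 0) (at 0)"
    using nrm_convergent_at_zero[OF R DH gram] by blast
  have evH: "\<forall>\<^sub>F t in at 0. sec_quot c t \<in> H" using evR by eventually_elim (rule DH)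
  have const: "\<forall>\<^sub>F t in at (0::complex). f \<in> H" "((\<lambda>t. nrm (\<lambda>x. f x - f x)) \<longlongrightarrow> 0) (at (0::complex))" if "f \<in> H" for f
    using that ip_zero_right[of f] nrm_diff_sq[of f f] by (simp_all add: nrm_def)
  have rep: "((\<lambda>t. (f (c t) - f (c 0)) / t) \<longlongrightarrow> ip f E) (at 0)" if f: "f \<in> H" for f
  proof (rule Lim_transform_eventually)
    show "((\<lambda>t. ip f (sec_quot c t)) \<longlongrightarrow> ip f E) (at 0)"
      by (rule ip_tendsto[OF const[OF f] f evH E(2,1)])
    show "\<forall>\<^sub>F t in at 0. ip f (sec_quot c t) = (f (c t) - f (c 0)) / t"
      using evR by eventually_elim (use ip_sec_quot f c c0 in auto)
  qed
  have "((\<lambda>t. (k x (c (cnj t)) - k x (c 0)) / t) \<longlongrightarrow> E x) (at 0)" if x: "x \<in> X" for x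
  proof -
    have "((\<lambda>t. ip (sec_quot c t) (sec x)) \<longlongrightarrow> ip E (sec x)) (at 0)"
      by (rule ip_tendsto[OF evH E(2,1) const[OF sec_mem[OF x]] sec_mem[OF x]])
    then have "((\<lambda>t. (k x (c t) - k x (c 0)) / cnj t) \<longlongrightarrow> E x) (at 0)"
      unfolding ip_sec[OF E(1) x]
    proof (rule Lim_transform_eventually)
      show "\<forall>\<^sub>F t in at 0. ip (sec_quot c t) (sec x) = (k x (c t) - k x (c 0)) / cnj t"
        using evR
      proof eventually_elim
        case (elim t)
        then show ?case using ip_sec[OF DH[OF elim] x] x by (simp add: sec_quot_def sec_apply)
      qed
    qed
    from filterlim_compose[OF this cnj0] show ?thesis by simp
  qed
  with E rep show thesis by (rule that)
qed

end

section \<open>The subspace of functions vanishing on the diagonal\<close>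

locale tensor_power_space = kernel_hilbert "\<Omega> \<times> \<Omega>" H ip "tensor_kernel K\<alpha> K\<beta>"
  for \<Omega> :: "(complex^'m) set" and H ip K\<alpha> K\<beta> +
  fixes K :: "complex^'m \<Rightarrow> complex^'m \<Rightarrow> complex" and \<alpha> \<beta> :: real
  assumes open_domain: "open \<Omega>" and K: "sesqui_analytic_on \<Omega> K"
    and pos: "\<alpha> > 0" "\<beta> > 0"
    and power_\<alpha>: "kernel_power_on \<Omega> K \<alpha> K\<alpha>" and power_\<beta>: "kernel_power_on \<Omega> K \<beta> K\<beta>"
begin

lemma sesqui_powers: "sesqui_analytic_on \<Omega> K\<alpha>" "sesqui_analytic_on \<Omega> K\<beta>"
  using power_\<alpha> power_\<beta> by (auto simp: kernel_power_on_def)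

text \<open>The directions \<open>a\<close> and \<open>b\<close> move the two points of the pair independently: \<open>(0, v)\<close> differentiates in
  the second point alone, while \<open>(v, v)\<close> is tangent to the diagonal.\<close>

lemma tensor_derivative_representer:
  assumes z: "z \<in> \<Omega>"
  obtains E where "E \<in> H"
    "((\<lambda>t. nrm (\<lambda>x. sec_quot (\<lambda>t. (z + t *s a, z + t *s b)) t x - E x)) \<longlongrightarrow> 0) (at 0)"
    "\<And>f. f \<in> H \<Longrightarrow> ((\<lambda>t. (f (z + t *s a, z + t *s b) - f (z, z)) / t) \<longlongrightarrow> ip f E) (at 0)"
    "\<And>u w. u \<in> \<Omega> \<Longrightarrow> w \<in> \<Omega> \<Longrightarrow>
       E (u, w) = conj_deriv a K\<alpha> u z * K\<beta> w z + K\<alpha> u z * conj_deriv b K\<beta> w z"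
proof -
  let ?k = "tensor_kernel K\<alpha> K\<beta>" and ?c = "\<lambda>t. (z + t *s a, z + t *s b)"
  obtain R1 R2 where R12: "R1 > 0" "\<And>s. s \<in> ball 0 R1 \<Longrightarrow> z + s *s a \<in> \<Omega>"
    "R2 > 0" "\<And>s. s \<in> ball 0 R2 \<Longrightarrow> z + s *s b \<in> \<Omega>"
    using line_stays_in_open[OF open_domain z] by metis
  define R where "R = min R1 R2"
  define r where "r = R / 2"
  have R: "R > 0" "\<And>s. s \<in> ball 0 R \<Longrightarrow> z + s *s a \<in> \<Omega>" "\<And>s. s \<in> ball 0 R \<Longrightarrow> z + s *s b \<in> \<Omega>"
    using R12 by (auto simp: R_def)
  have Rc: "z + cnj s *s a \<in> \<Omega>" "z + cnj s *s b \<in> \<Omega>" if "s \<in> ball 0 R" for s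
    using R(2,3)[of "cnj s"] that by auto
  have r: "0 < r" "r < R" "cball 0 r \<subseteq> ball (0::complex) R" using R(1) by (auto simp: r_def)
  obtain M where M: "\<And>s t. s \<in> cball 0 r \<Longrightarrow> t \<in> cball 0 r \<Longrightarrow> cmod (K\<alpha> (z + s *s a) (z + cnj t *s a)) \<le> M"
    using sesqui_analytic_bounded_on_bidisc[OF sesqui_powers(1), of r z a z a] R r by blast
  obtain N where N: "\<And>s t. s \<in> cball 0 r \<Longrightarrow> t \<in> cball 0 r \<Longrightarrow> cmod (K\<beta> (z + s *s b) (z + cnj t *s b)) \<le> N"
    using sesqui_analytic_bounded_on_bidisc[OF sesqui_powers(2), of r z b z b] R r by blast
  have M0: "M \<ge> 0" by (rule order_trans[OF norm_ge_zero M[of 0 0]]) (use r in auto)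
  obtain E where E: "E \<in> H" "((\<lambda>t. nrm (\<lambda>x. sec_quot ?c t x - E x)) \<longlongrightarrow> 0) (at 0)"
    "\<And>f. f \<in> H \<Longrightarrow> ((\<lambda>t. (f (?c t) - f (?c 0)) / t) \<longlongrightarrow> ip f E) (at 0)"
    "\<And>x. x \<in> \<Omega> \<times> \<Omega> \<Longrightarrow> ((\<lambda>t. (?k x (?c (cnj t)) - ?k x (?c 0)) / t) \<longlongrightarrow> E x) (at 0)"
  proof (rule kernel_derivative_representer[of r R ?c "M * N"])
    show "?c t \<in> \<Omega> \<times> \<Omega>" if "t \<in> ball 0 R" for t using R that by simp
    show "(\<lambda>s. ?k (?c s) (?c (cnj t))) holomorphic_on ball 0 R" if "t \<in> ball 0 R" for t
      unfolding tensor_kernel_def fst_conv snd_conv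
      by (intro holomorphic_on_mult sesqui_analytic_left[OF sesqui_powers(1)]
          sesqui_analytic_left[OF sesqui_powers(2)] open_ball R Rc that)
    show "(\<lambda>t. ?k (?c s) (?c (cnj t))) holomorphic_on ball 0 R" if "s \<in> ball 0 R" for s
      unfolding tensor_kernel_def fst_conv snd_conv
      by (intro holomorphic_on_mult sesqui_analytic_right[OF sesqui_powers(1)]
          sesqui_analytic_right[OF sesqui_powers(2)] open_ball R Rc that)
    show "cmod (?k (?c s) (?c (cnj t))) \<le> M * N" if "s \<in> cball 0 r" "t \<in> cball 0 r" for s t
      unfolding tensor_kernel_def fst_conv snd_conv norm_mult
      by (rule mult_mono[OF M[OF that] N[OF that] M0 norm_ge_zero])
  qed (use r in blast)+
  have "E (u, w) = conj_deriv a K\<alpha> u z * K\<beta> w z + K\<alpha> u z * conj_deriv b K\<beta> w z"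
    if uw: "u \<in> \<Omega>" "w \<in> \<Omega>" for u w
  proof (rule tendsto_unique[OF at_neq_bot E(4)])
    have "((\<lambda>t. K\<alpha> u (z + cnj t *s a) * K\<beta> w (z + cnj t *s b)) has_field_derivative
        conj_deriv a K\<alpha> u z * K\<beta> w z + K\<alpha> u z * conj_deriv b K\<beta> w z) (at 0)"
      using DERIV_mult[OF has_conj_deriv[OF sesqui_powers(1) open_domain uw(1) z, of a]
          has_conj_deriv[OF sesqui_powers(2) open_domain uw(2) z, of b]]
      by (simp add: algebra_simps)
    then show "((\<lambda>t. (?k (u, w) (?c (cnj t)) - ?k (u, w) (?c 0)) / t) \<longlongrightarrow>
        conj_deriv a K\<alpha> u z * K\<beta> w z + K\<alpha> u z * conj_deriv b K\<beta> w z) (at 0)"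
      by (simp add: has_field_derivative_iff tensor_kernel_def)
  qed (use uw in simp)
  with E(1,2) E(3) show thesis by (intro that) auto
qed

text \<open>Both sides are \<open>\<alpha> \<beta> K\<^sup>\<alpha>\<^sup>+\<^sup>\<beta>\<close> times the logarithmic derivative of \<open>K\<close>.  At a zero of \<open>K\<close>
  both powers vanish, and with them both sides.\<close>

lemma conj_deriv_powers_proportional:
  assumes u: "u \<in> \<Omega>" and z: "z \<in> \<Omega>"
  shows "\<alpha> * K\<alpha> u z * conj_deriv v K\<beta> u z = \<beta> * conj_deriv v K\<alpha> u z * K\<beta> u z"
proof (cases "K u z = 0")
  case True
  then have "K\<alpha> u z = 0" "K\<beta> u z = 0"
    using power_\<alpha> power_\<beta> u z unfolding kernel_power_on_def by auto
  then show ?thesis by simp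
next
  case False
  have "\<alpha> * K\<alpha> u z * (conj_deriv v K\<beta> u z * K u z) = \<beta> * (conj_deriv v K\<alpha> u z * K u z) * K\<beta> u z"
    unfolding conj_deriv_power[OF K power_\<alpha> open_domain u z] conj_deriv_power[OF K power_\<beta> open_domain u z]
    by simp
  then have "(\<alpha> * K\<alpha> u z * conj_deriv v K\<beta> u z) * K u z = (\<beta> * conj_deriv v K\<alpha> u z * K\<beta> u z) * K u z"
    by (simp only: mult.assoc mult.commute mult.left_commute)
  then show ?thesis using False by simp
qed

lemma vanish_memD: "f \<in> vanish_on_diagonal \<Omega> H \<Longrightarrow> f \<in> H"
  "f \<in> vanish_on_diagonal \<Omega> H \<Longrightarrow> z \<in> \<Omega> \<Longrightarrow> f (z, z) = 0"
  by (auto simp: vanish_on_diagonal_def)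

text \<open>Let \<open>E\<close> represent differentiation at \<open>(z, z)\<close> in the second point and \<open>G\<close> differentiation along the
  diagonal.  Functions that vanish on the diagonal are orthogonal to \<open>G\<close>, and subtracting
  \<open>\<beta> / (\<alpha> + \<beta>)\<close> times \<open>G\<close> from \<open>E\<close> gives a function \<open>V\<close> that itself vanishes on the diagonal, by the
  proportionality of the derivatives of the two powers.  So \<open>V\<close> is the orthogonal projection of \<open>E\<close>, in
  closed form.  The normalized sections of the kernel of the subspace are the projections of the
  difference quotients in the large space, and a projection does not increase distances; hence they
  tend to \<open>V\<close>.\<close>

lemma projected_derivative:
  assumes KA: "reproducing_kernel (\<Omega> \<times> \<Omega>) (vanish_on_diagonal \<Omega> H) ip KA" and z: "z \<in> \<Omega>"
  obtains V where "V \<in> vanish_on_diagonal \<Omega> H"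
    "((\<lambda>t. nrm (\<lambda>x. (1 / cnj t) * kernel_section (\<Omega> \<times> \<Omega>) KA (z, z + t *s v) x - V x)) \<longlongrightarrow> 0) (at 0)"
    "\<And>f. f \<in> vanish_on_diagonal \<Omega> H \<Longrightarrow> ((\<lambda>t. f (z, z + t *s v) / t) \<longlongrightarrow> ip f V) (at 0)"
    "\<And>u w. u \<in> \<Omega> \<Longrightarrow> w \<in> \<Omega> \<Longrightarrow> V (u, w) =
       (\<alpha> * K\<alpha> u z * conj_deriv v K\<beta> w z - \<beta> * conj_deriv v K\<alpha> u z * K\<beta> w z) / of_real (\<alpha> + \<beta>)"
proof -
  let ?A = "vanish_on_diagonal \<Omega> H"
  obtain E where E: "E \<in> H"
    "((\<lambda>t. nrm (\<lambda>x. sec_quot (\<lambda>t. (z + t *s 0, z + t *s v)) t x - E x)) \<longlongrightarrow> 0) (at 0)"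
    "\<And>f. f \<in> H \<Longrightarrow> ((\<lambda>t. (f (z + t *s 0, z + t *s v) - f (z, z)) / t) \<longlongrightarrow> ip f E) (at 0)"
    "\<And>u w. u \<in> \<Omega> \<Longrightarrow> w \<in> \<Omega> \<Longrightarrow>
       E (u, w) = conj_deriv 0 K\<alpha> u z * K\<beta> w z + K\<alpha> u z * conj_deriv v K\<beta> w z"
    using tensor_derivative_representer[OF z, of 0 v] by blast
  obtain G where G: "G \<in> H"
    "\<And>f. f \<in> H \<Longrightarrow> ((\<lambda>t. (f (z + t *s v, z + t *s v) - f (z, z)) / t) \<longlongrightarrow> ip f G) (at 0)"
    "\<And>u w. u \<in> \<Omega> \<Longrightarrow> w \<in> \<Omega> \<Longrightarrow>
       G (u, w) = conj_deriv v K\<alpha> u z * K\<beta> w z + K\<alpha> u z * conj_deriv v K\<beta> w z"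
    by (rule tensor_derivative_representer[OF z, of v v]) (rule that)
  obtain R where R: "R > 0" "\<And>s. s \<in> ball 0 R \<Longrightarrow> z + s *s v \<in> \<Omega>"
    using line_stays_in_open[OF open_domain z] by blast
  have evR: "\<forall>\<^sub>F t in at 0. t \<in> ball (0::complex) R"
    using R by (auto simp: eventually_at dist_norm intro!: exI[of _ R])
  have G_orth: "ip f G = 0" if f: "f \<in> ?A" for f
  proof (rule tendsto_unique[OF at_neq_bot G(2)[OF vanish_memD(1)[OF f]]])
    have "\<forall>\<^sub>F t in at 0. 0 = (f (z + t *s v, z + t *s v) - f (z, z)) / t"
      using evR by eventually_elim (use R vanish_memD(2)[OF f] z in simp)
    then show "((\<lambda>t. (f (z + t *s v, z + t *s v) - f (z, z)) / t) \<longlongrightarrow> 0) (at 0)"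
      by (rule Lim_transform_eventually[OF tendsto_const])
  qed
  \<comment> \<open>This weight is the one that makes the combination vanish on the diagonal.\<close>
  define \<mu> where "\<mu> = complex_of_real (\<beta> / (\<alpha> + \<beta>))"
  define V where "V = (\<lambda>x. E x - \<mu> * G x)"
  have cG: "(\<lambda>x. \<mu> * G x) \<in> H" by (rule scale_mem[OF G(1)])
  have VH: "V \<in> H" unfolding V_def by (rule diff_mem[OF E(1) cG])
  have ab: "complex_of_real \<alpha> + complex_of_real \<beta> \<noteq> 0"
    using pos by (simp flip: of_real_add)
  have V: "V (u, w) = (\<alpha> * K\<alpha> u z * conj_deriv v K\<beta> w z - \<beta> * conj_deriv v K\<alpha> u z * K\<beta> w z) / of_real (\<alpha> + \<beta>)"
    if "u \<in> \<Omega>" "w \<in> \<Omega>" for u w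
    using ab by (simp add: V_def \<mu>_def E(4)[OF that] G(3)[OF that] divide_simps) (simp add: algebra_simps)
  have VA: "V \<in> ?A"
    using VH V conj_deriv_powers_proportional z by (simp add: vanish_on_diagonal_def)
  have ipV: "ip f V = ip f E" if f: "f \<in> ?A" for f
    unfolding V_def ip_diff_right[OF E(1) cG vanish_memD(1)[OF f]]
      ip_scale_right[OF G(1) vanish_memD(1)[OF f]] G_orth[OF f] by simp
  have rep: "((\<lambda>t. f (z, z + t *s v) / t) \<longlongrightarrow> ip f V) (at 0)" if f: "f \<in> ?A" for f
    using E(3)[OF vanish_memD(1)[OF f]] vanish_memD(2)[OF f z] ipV[OF f] by simp
  let ?N = "\<lambda>t x. (1 / cnj t) * kernel_section (\<Omega> \<times> \<Omega>) KA (z, z + t *s v) x"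
  let ?D = "sec_quot (\<lambda>t. (z + t *s 0, z + t *s v))"
  have "((\<lambda>t. nrm (\<lambda>x. ?N t x - V x)) \<longlongrightarrow> 0) (at 0)"
  proof (rule Lim_null_comparison[OF _ E(2)])
    show "\<forall>\<^sub>F t in at 0. norm (nrm (\<lambda>x. ?N t x - V x)) \<le> nrm (\<lambda>x. ?D t x - E x)"
      using evR
    proof eventually_elim
      case (elim t)
      have p: "(z, z + t *s v) \<in> \<Omega> \<times> \<Omega>" using R(2)[OF elim] z by simp
      let ?k = "kernel_section (\<Omega> \<times> \<Omega>) KA (z, z + t *s v)"
      have kA: "?k \<in> ?A" and ipk: "\<And>f. f \<in> ?A \<Longrightarrow> f (z, z + t *s v) = ip f ?k"
        using KA p unfolding reproducing_kernel_def by blast+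
      have kH: "?k \<in> H" by (rule vanish_memD(1)[OF kA])
      have NH: "?N t \<in> H" by (rule scale_mem[OF kH])
      have DH: "?D t \<in> H" by (rule sec_quot_mem) (use R(2)[OF elim] z in auto)
      define W where "W = (\<lambda>x. ?N t x - V x)"
      have WH: "W \<in> H" unfolding W_def by (rule diff_mem[OF NH VH])
      have WA: "W \<in> ?A"
        using WH vanish_memD(2)[OF kA] vanish_memD(2)[OF VA]
        by (simp add: vanish_on_diagonal_def W_def)
      \<comment> \<open>Both vectors represent the same difference quotient, because W vanishes at (z, z).\<close>
      have "ip W (?N t) = W (z, z + t *s v) / t"
        unfolding ip_scale_right[OF kH WH] ipk[OF WA] by simp
      also have "\<dots> = ip W (?D t)"
        using ip_sec_quot[OF WH, of "\<lambda>t. (z + t *s 0, z + t *s v)" t] R(2)[OF elim] z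
          vanish_memD(2)[OF WA z] by simp
      finally have "ip W W = ip W (\<lambda>x. ?D t x - E x)"
        using ip_diff_right[OF NH VH WH] ip_diff_right[OF DH E(1) WH] ipV[OF WA] by (simp add: W_def)
      then have "cmod (ip W W) \<le> nrm W * nrm (\<lambda>x. ?D t x - E x)"
        using cauchy_schwarz[OF WH diff_mem[OF DH E(1)]] by simp
      then have "nrm W * nrm W \<le> nrm W * nrm (\<lambda>x. ?D t x - E x)"
        unfolding ip_self[OF WH] norm_of_real by (simp add: power2_eq_square)
      then have "nrm W \<le> nrm (\<lambda>x. ?D t x - E x)"
        using nrm_nonneg[OF WH] nrm_nonneg[OF diff_mem[OF DH E(1)]]
        by (cases "nrm W = 0") (auto simp: mult_le_cancel_left)
      then show ?case using nrm_nonneg[OF WH] by (simp add: W_def)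
    qed
  qed
  with VA show thesis using rep V by (rule that)
qed

end

section \<open>The limit of the kernel of the subspace\<close>

text \<open>The value is non-negative, so it equals its modulus, and the modulus of \<open>exp (a * l)\<close> does not
  depend on the chosen logarithm.\<close>

lemma kernel_power_diagonal:
  assumes P: "kernel_power_on W K a P" "nonneg_definite_on W P" and z: "z \<in> W" "K z z \<noteq> 0"
  shows "P z z = complex_of_real (cmod (K z z) powr a)"
proof -
  have "P z z \<in> \<real>\<^sub>\<ge>\<^sub>0"
    using P(2)[unfolded nonneg_definite_on_def, rule_format, of "{z}" "\<lambda>_. 1"] z by simp
  then have "P z z = complex_of_real (cmod (P z z))"
    by (auto simp: complex_nonneg_Reals_iff cmod_eq_Re complex_eq_iff)
  moreover obtain l where l: "exp l = K z z" "P z z = exp (of_real a * l)"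
    using P(1) z unfolding kernel_power_on_def by (metis (no_types, lifting))
  have "cmod (P z z) = cmod (K z z) powr a"
    unfolding l(2) l(1)[symmetric] by (simp add: norm_exp_eq_Re powr_def)
  ultimately show ?thesis by simp
qed

text \<open>The quotient is the inner product of the normalized sections in the directions \<open>j\<close> and \<open>i\<close>, so it
  tends to the inner product of their limits \<open>V\<close> and \<open>W\<close>.  As \<open>W\<close> represents differentiation in the
  second point, this inner product is a derivative of the explicit function \<open>V\<close>.  Near \<open>z\<close> the
  derivatives of the powers of \<open>K\<close> can be written with \<open>L\<close>, which turns \<open>V (z, w)\<close> into a multiple of
  \<open>K\<beta> w z\<close> times the increment from \<open>z\<close> to \<open>w\<close> of the conjugate derivative of \<open>L\<close>; dividing that
  increment by \<open>s\<close> leaves the mixed derivative.\<close>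

lemma (in tensor_power_space) vanishing_kernel_quotient_tendsto:
  assumes KA: "reproducing_kernel (\<Omega> \<times> \<Omega>) (vanish_on_diagonal \<Omega> H) ip KA" and z: "z \<in> \<Omega>"
    and L: "log_branch_near z K L"
  shows "((\<lambda>(s, t). KA (z, z + s *s axis i 1) (z, z + t *s axis j 1) / (s * cnj t)) \<longlongrightarrow>
     complex_of_real (\<alpha> * \<beta> / (\<alpha> + \<beta>)) * (K\<alpha> z z * K\<beta> z z) * mixed_partial i j L z z) (at 0 \<times>\<^sub>F at 0)"
proof -
  let ?A = "vanish_on_diagonal \<Omega> H"
  let ?i = "axis i 1 :: complex^'m" and ?j = "axis j 1 :: complex^'m"
  let ?k = "kernel_section (\<Omega> \<times> \<Omega>) KA"
  let ?N = "\<lambda>v t x. (1 / cnj t) * ?k (z, z + t *s v) x"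
  let ?R = "complex_of_real (\<alpha> * \<beta> / (\<alpha> + \<beta>)) * (K\<alpha> z z * K\<beta> z z) * mixed_partial i j L z z"
  obtain V where V: "V \<in> ?A" "((\<lambda>t. nrm (\<lambda>x. ?N ?j t x - V x)) \<longlongrightarrow> 0) (at 0)"
    "\<And>u w. u \<in> \<Omega> \<Longrightarrow> w \<in> \<Omega> \<Longrightarrow> V (u, w) =
       (\<alpha> * K\<alpha> u z * conj_deriv ?j K\<beta> w z - \<beta> * conj_deriv ?j K\<alpha> u z * K\<beta> w z) / of_real (\<alpha> + \<beta>)"
    by (rule projected_derivative[OF KA z, of ?j]) (rule that)
  obtain W where W: "W \<in> ?A" "((\<lambda>t. nrm (\<lambda>x. ?N ?i t x - W x)) \<longlongrightarrow> 0) (at 0)"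
    "\<And>f. f \<in> ?A \<Longrightarrow> ((\<lambda>t. f (z, z + t *s ?i) / t) \<longlongrightarrow> ip f W) (at 0)"
    by (rule projected_derivative[OF KA z, of ?i]) (rule that)
  obtain U where U: "open U" "z \<in> U" "sesqui_analytic_on U L" "\<And>u w. u \<in> U \<Longrightarrow> w \<in> U \<Longrightarrow> exp (L u w) = K u w"
    using L unfolding log_branch_near_def by blast
  define D where "D = U \<inter> \<Omega>"
  have D: "open D" "z \<in> D" "D \<subseteq> \<Omega>" "\<And>u w. u \<in> D \<Longrightarrow> w \<in> D \<Longrightarrow> exp (L u w) = K u w"
    using U open_domain z by (auto simp: D_def)
  have LD: "sesqui_analytic_on D L" using U(3) unfolding sesqui_analytic_on_def D_def by blast
  have log_deriv: "conj_deriv v P w z = of_real a * conj_deriv v L w z * P w z"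
    if P: "kernel_power_on \<Omega> K a P" and w: "w \<in> D" for a P w v
  proof -
    have "K w z \<noteq> 0" using D(4)[OF w D(2)] exp_not_eq_zero by metis
    moreover have "conj_deriv v P w z * K w z = of_real a * (conj_deriv v L w z * K w z) * P w z"
      using conj_deriv_power[OF K P open_domain, of w z v] w D(3) z
        conj_deriv_log[OF LD D(1) w D(2), of K v] D(4)[OF w] by auto
    ultimately show ?thesis by (simp add: field_simps)
  qed
  obtain R where R: "R > 0" "\<And>s. s \<in> ball 0 R \<Longrightarrow> z + s *s ?i \<in> D" "\<And>s. s \<in> ball 0 R \<Longrightarrow> z + s *s ?j \<in> D"
  proof -
    obtain R1 R2 where "R1 > 0" "\<And>s. s \<in> ball 0 R1 \<Longrightarrow> z + s *s ?i \<in> D"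
      "R2 > 0" "\<And>s. s \<in> ball 0 R2 \<Longrightarrow> z + s *s ?j \<in> D"
      using line_stays_in_open[OF D(1,2)] by metis
    then show thesis by (intro that[of "min R1 R2"]) auto
  qed
  have evR: "\<forall>\<^sub>F t in at 0. t \<in> ball (0::complex) R"
    using R by (auto simp: eventually_at dist_norm intro!: exI[of _ R])
  have kA: "?k (z, z + t *s v) \<in> ?A" if "z + t *s v \<in> D" for t v
    using KA that z D(3) unfolding reproducing_kernel_def by blast
  have NH: "?N v t \<in> H" if "z + t *s v \<in> D" for t v
    by (rule scale_mem[OF vanish_memD(1)[OF kA[OF that]]])

  have "((\<lambda>s. complex_of_real (\<alpha> * \<beta> / (\<alpha> + \<beta>)) * (K\<alpha> z z * K\<beta> (z + s *s ?i) z) *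
      ((conj_deriv ?j L (z + s *s ?i) z - conj_deriv ?j L z z) / s)) \<longlongrightarrow> ?R) (at 0)"
  proof (intro tendsto_intros conj_deriv_tendsto_mixed_partial[OF LD D(1,2)])
    have "(\<lambda>s. K\<beta> (z + s *s ?i) z) holomorphic_on ball 0 R"
      by (rule sesqui_analytic_left[OF sesqui_powers(2)]) (use R D(3) z in auto)
    from holomorphic_on_imp_continuous_on[OF this] have "isCont (\<lambda>s. K\<beta> (z + s *s ?i) z) 0"
      using R(1) by (simp add: continuous_on_eq_continuous_at)
    then show "((\<lambda>s. K\<beta> (z + s *s ?i) z) \<longlongrightarrow> K\<beta> z z) (at 0)" by (simp add: isCont_def)
  qed
  moreover have "\<forall>\<^sub>F s in at 0. complex_of_real (\<alpha> * \<beta> / (\<alpha> + \<beta>)) * (K\<alpha> z z * K\<beta> (z + s *s ?i) z) *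
      ((conj_deriv ?j L (z + s *s ?i) z - conj_deriv ?j L z z) / s) = V (z, z + s *s ?i) / s"
    using evR
  proof eventually_elim
    case (elim s)
    have w: "z + s *s ?i \<in> D" "z + s *s ?i \<in> \<Omega>" using R(2)[OF elim] D(3) by auto
    show ?case
      unfolding V(3)[OF z w(2)] log_deriv[OF power_\<alpha> D(2)] log_deriv[OF power_\<beta> w(1)]
      by (simp add: diff_divide_distrib algebra_simps)
  qed
  ultimately have "((\<lambda>s. V (z, z + s *s ?i) / s) \<longlongrightarrow> ?R) (at 0)"
    by (rule Lim_transform_eventually)
  \<comment> \<open>The same quotients tend to the inner product, since W represents the derivative.\<close>
  then have VW: "ip V W = ?R" by (rule tendsto_unique[OF at_neq_bot W(3)[OF V(1)]])

  have "((\<lambda>p. ip (?N ?j (snd p)) (?N ?i (fst p))) \<longlongrightarrow> ip V W) (at 0 \<times>\<^sub>F at 0)"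
  proof (rule ip_tendsto)
    show "\<forall>\<^sub>F p in at 0 \<times>\<^sub>F at 0. ?N ?j (snd p) \<in> H"
      by (rule eventually_compose_filterlim[OF _ filterlim_snd]) (use evR in eventually_elim, use NH R in blast)
    show "\<forall>\<^sub>F p in at 0 \<times>\<^sub>F at 0. ?N ?i (fst p) \<in> H"
      by (rule eventually_compose_filterlim[OF _ filterlim_fst]) (use evR in eventually_elim, use NH R in blast)
    show "((\<lambda>p. nrm (\<lambda>x. ?N ?j (snd p) x - V x)) \<longlongrightarrow> 0) (at 0 \<times>\<^sub>F at 0)"
      by (rule filterlim_compose[OF V(2) filterlim_snd])
    show "((\<lambda>p. nrm (\<lambda>x. ?N ?i (fst p) x - W x)) \<longlongrightarrow> 0) (at 0 \<times>\<^sub>F at 0)"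
      by (rule filterlim_compose[OF W(2) filterlim_fst])
  qed (use V(1) W(1) vanish_memD in blast)+
  moreover have "\<forall>\<^sub>F p in at 0 \<times>\<^sub>F at 0. ip (?N ?j (snd p)) (?N ?i (fst p)) =
      (case p of (s, t) \<Rightarrow> KA (z, z + s *s ?i) (z, z + t *s ?j) / (s * cnj t))"
  proof -
    have "\<forall>\<^sub>F p in at 0 \<times>\<^sub>F at (0::complex). fst p \<in> ball (0::complex) R \<and> snd p \<in> ball 0 R"
      using evR by (auto simp: eventually_prod_filter)
    then show ?thesis
    proof eventually_elim
      case (elim p)
      obtain s t where p: "p = (s, t)" by force
      have st: "z + s *s ?i \<in> D" "z + t *s ?j \<in> D" using elim R by (auto simp: p)
      note ki = kA[OF st(1)] and kj = kA[OF st(2)]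
      have "ip (?k (z, z + t *s ?j)) (?k (z, z + s *s ?i)) = ?k (z, z + t *s ?j) (z, z + s *s ?i)"
        using KA kj z st D(3) unfolding reproducing_kernel_def by (metis (no_types, lifting) SigmaI subsetD)
      also have "\<dots> = KA (z, z + s *s ?i) (z, z + t *s ?j)"
        using st z D(3) by (auto simp: kernel_section_def)
      finally show ?case
        unfolding p fst_conv snd_conv prod.case
          ip_scale_right[OF vanish_memD(1)[OF ki] NH[OF st(2)]]
          ip_scale_left[OF vanish_memD(1)[OF kj] vanish_memD(1)[OF ki]]
        by simp
    qed
  qed
  ultimately show ?thesis unfolding VW by (rule Lim_transform_eventually)
qed

lemma coord_slice_point:
  assumes "\<zeta> \<in> coord_slice \<Omega> z {i}"
  shows "z + (\<zeta> $ i - z $ i) *s axis i 1 = \<zeta>"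
  using assms by (auto simp: coord_slice_def vec_eq_iff axis_def)

lemma filterlim_coord_slice:
  "filterlim (\<lambda>\<zeta>. \<zeta> $ i - z $ i) (at 0) (at z within coord_slice \<Omega> z {i})"
proof (rule filterlim_atI)
  have "((\<lambda>\<zeta>. \<zeta> $ i - z $ i) \<longlongrightarrow> z $ i - z $ i) (at z within coord_slice \<Omega> z {i})"
    by (intro tendsto_intros)
  then show "((\<lambda>\<zeta>. \<zeta> $ i - z $ i) \<longlongrightarrow> 0) (at z within coord_slice \<Omega> z {i})" by simp
  show "\<forall>\<^sub>F \<zeta> in at z within coord_slice \<Omega> z {i}. \<zeta> $ i - z $ i \<noteq> 0"
    unfolding eventually_at_topological
  proof (intro exI[of _ UNIV] conjI ballI impI)
    fix \<zeta> assume "\<zeta> \<noteq> z" "\<zeta> \<in> coord_slice \<Omega> z {i}"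
    then show "\<zeta> $ i - z $ i \<noteq> 0" using coord_slice_point[of \<zeta> \<Omega> z i] by force
  qed auto
qed

theorem theorem3p4:
  fixes \<Omega> :: "(complex^'m) set"
    and K K\<alpha> K\<beta> L :: "complex^'m \<Rightarrow> complex^'m \<Rightarrow> complex"
    and \<alpha> \<beta> :: real
    and H :: "((complex^'m) \<times> (complex^'m) \<Rightarrow> complex) set"
    and ip :: "((complex^'m) \<times> (complex^'m) \<Rightarrow> complex) \<Rightarrow>
               ((complex^'m) \<times> (complex^'m) \<Rightarrow> complex) \<Rightarrow> complex"
    and KA :: "(complex^'m) \<times> (complex^'m) \<Rightarrow> (complex^'m) \<times> (complex^'m) \<Rightarrow> complex"
    and z :: "complex^'m"
    and i j :: 'm
  assumes "open \<Omega>" and "connected \<Omega>" and "bounded \<Omega>"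
    and "sesqui_analytic_on \<Omega> K"
    and "\<alpha> > 0" and "\<beta> > 0"
    and "kernel_power_on \<Omega> K \<alpha> K\<alpha>" and "nonneg_definite_on \<Omega> K\<alpha>"
    and "kernel_power_on \<Omega> K \<beta> K\<beta>" and "nonneg_definite_on \<Omega> K\<beta>"
    and "rkhs (\<Omega> \<times> \<Omega>) H ip (tensor_kernel K\<alpha> K\<beta>)"
    and "reproducing_kernel (\<Omega> \<times> \<Omega>) (vanish_on_diagonal \<Omega> H) ip KA"
    and "z \<in> \<Omega>"
    and "log_branch_near z K L"
  shows
    "let R = complex_of_real (\<alpha> * \<beta> / (\<alpha> + \<beta>)) * complex_of_real (cmod (K z z) powr (\<alpha> + \<beta>))
             * mixed_partial i j L z z
     in (i = j \<longrightarrow>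
          ((\<lambda>\<zeta>. KA (z, \<zeta>) (z, \<zeta>) / ((z $ i - \<zeta> $ i) * (cnj (z $ j) - cnj (\<zeta> $ j)))) \<longlongrightarrow> R)
            (at z within coord_slice \<Omega> z {i, j})) \<and>
        ((\<lambda>(\<zeta>, \<rho>). KA (z, \<zeta>) (z, \<rho>) / ((z $ i - \<zeta> $ i) * (cnj (z $ j) - cnj (\<rho> $ j)))) \<longlongrightarrow> R)
            ((at z within coord_slice \<Omega> z {i}) \<times>\<^sub>F (at z within coord_slice \<Omega> z {j}))"
proof -
  interpret tensor_power_space \<Omega> H ip K\<alpha> K\<beta> K \<alpha> \<beta>
    using assms(1,4-7,9,11)
    by unfold_locales (auto simp: rkhs_def)
  define R where "R = complex_of_real (\<alpha> * \<beta> / (\<alpha> + \<beta>)) * complex_of_real (cmod (K z z) powr (\<alpha> + \<beta>))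
             * mixed_partial i j L z z"
  let ?F = "\<lambda>i. at z within coord_slice \<Omega> z {i}"
  let ?Q = "\<lambda>(\<zeta>, \<rho>). KA (z, \<zeta>) (z, \<rho>) / ((z $ i - \<zeta> $ i) * (cnj (z $ j) - cnj (\<rho> $ j)))"
  have "K z z \<noteq> 0"
    using assms(14) exp_not_eq_zero unfolding log_branch_near_def by metis
  then have KK: "K\<alpha> z z * K\<beta> z z = complex_of_real (cmod (K z z) powr (\<alpha> + \<beta>))"
    using kernel_power_diagonal[OF assms(7,8,13)] kernel_power_diagonal[OF assms(9,10,13)]
    by (simp add: powr_add)
  have "filterlim (\<lambda>p. (fst p $ i - z $ i, snd p $ j - z $ j)) (at 0 \<times>\<^sub>F at 0) (?F i \<times>\<^sub>F ?F j)"
    by (intro filterlim_Pair filterlim_compose[OF filterlim_coord_slice filterlim_fst]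
        filterlim_compose[OF filterlim_coord_slice filterlim_snd])
  from filterlim_compose[OF vanishing_kernel_quotient_tendsto[OF assms(12,13,14), of i j] this]
  have "((\<lambda>p. KA (z, z + (fst p $ i - z $ i) *s axis i 1) (z, z + (snd p $ j - z $ j) *s axis j 1)
      / ((fst p $ i - z $ i) * cnj (snd p $ j - z $ j))) \<longlongrightarrow> R) (?F i \<times>\<^sub>F ?F j)"
    by (simp add: R_def KK)
  moreover have "\<forall>\<^sub>F p in ?F i \<times>\<^sub>F ?F j.
      KA (z, z + (fst p $ i - z $ i) *s axis i 1) (z, z + (snd p $ j - z $ j) *s axis j 1)
      / ((fst p $ i - z $ i) * cnj (snd p $ j - z $ j)) = ?Q p"
  proof -
    have ev: "\<forall>\<^sub>F \<zeta> in ?F l. \<zeta> \<in> coord_slice \<Omega> z {l}" for l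
      by (simp add: eventually_at_topological) (metis open_UNIV UNIV_I)
    have "\<forall>\<^sub>F p in ?F i \<times>\<^sub>F ?F j. fst p \<in> coord_slice \<Omega> z {i} \<and> snd p \<in> coord_slice \<Omega> z {j}"
      using ev[of i] ev[of j] by (auto simp: eventually_prod_filter)
    then show ?thesis
    proof eventually_elim
      case (elim p)
      have "(fst p $ i - z $ i) * cnj (snd p $ j - z $ j)
          = (z $ i - fst p $ i) * (cnj (z $ j) - cnj (snd p $ j))"
        by (simp add: algebra_simps)
      then show ?case
        unfolding coord_slice_point[OF conjunct1[OF elim]] coord_slice_point[OF conjunct2[OF elim]]
        by (simp add: case_prod_unfold)
    qed
  qed
  ultimately have two: "(?Q \<longlongrightarrow> R) (?F i \<times>\<^sub>F ?F j)"
    by (rule Lim_transform_eventually)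
  \<comment> \<open>The first limit is the second one along pairs with equal entries.\<close>
  have one: "((\<lambda>\<zeta>. KA (z, \<zeta>) (z, \<zeta>) / ((z $ i - \<zeta> $ i) * (cnj (z $ j) - cnj (\<zeta> $ j)))) \<longlongrightarrow> R)
      (at z within coord_slice \<Omega> z {i, j})" if "i = j"
  proof -
    have "filterlim (\<lambda>\<zeta>. (\<zeta>, \<zeta>)) (?F i \<times>\<^sub>F ?F j) (?F i)"
      using that by (simp add: filterlim_Pair filterlim_ident)
    from filterlim_compose[OF two this] show ?thesis using that by simp
  qed
  show ?thesis unfolding Let_def R_def[symmetric] using one two by blast
qed

end
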